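(* Let $\zeta\in\mathbb{C}$ with $\zeta^3=1$, $\zeta\neq1$, and consider the system on $\mathbb{C}^3$ $$\dot x_1=x_1+a_{100}x_1^2+a_{010}x_1x_2+a_{001}x_1x_3,\qquad \dot x_2=\zeta(x_2+b_{100}x_1x_2+x_2^2),\qquad \dot x_3=\zeta^2(x_3+c_{010}x_2x_3+c_{001}x_3^2)$$ with complex parameters $a_{100},a_{010},a_{001},b_{100},c_{010},c_{001}$. If the parameters belong to the variety of one of the ideals $$J_1=\langle c_{001},a_{001}\rangle,\quad J_4=\langle b_{100},a_{100}\rangle,\quad J_5=\langle b_{100},a_{001}\rangle,\quad J_8=\langle c_{010},a_{001}\rangle,\quad J_9=\langle b_{100},\,a_{010}-\zeta c_{010}\rangle,$$ then the corresponding system is linearizable.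
   Context: The parameters belong to the variety of an ideal if all generators of the ideal vanish at the parameters. The system is linearizable if there is an analytic change of coordinates $x=y+h(y)$ in a neighbourhood of the origin, with $h$ a vector of convergent power series starting with terms of degree at least two, which transforms it to the linear system $\dot y_1=y_1$, $\dot y_2=\zeta y_2$, $\dot y_3=\zeta^2y_3$. *)

theory Defs
  imports "HOL-Analysis.Analysis"
begin

record params =
  a100 :: complex
  a010 :: complex
  a001 :: complex
  b100 :: complex
  c010 :: complex
  c001 :: complex

definition sys_field :: "complex \<Rightarrow> params \<Rightarrow> complex^3 \<Rightarrow> complex^3" where
  "sys_field \<zeta> p x = vector
     [x$1 + a100 p * (x$1)^2 + a010 p * x$1 * x$2 + a001 p * x$1 * x$3,
      \<zeta> * (x$2 + b100 p * x$1 * x$2 + (x$2)^2),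
      \<zeta>^2 * (x$3 + c010 p * x$2 * x$3 + c001 p * (x$3)^2)]"

definition lin_field :: "complex \<Rightarrow> complex^3 \<Rightarrow> complex^3" where
  "lin_field \<zeta> y = vector [y$1, \<zeta> * y$2, \<zeta>^2 * y$3]"

(* An ideal of the polynomial ring in the six parameters is given by a set of generators,
   each generator being a polynomial function of the parameters. *)
definition variety :: "(params \<Rightarrow> complex) set \<Rightarrow> params set" where
  "variety G = {p. \<forall>g\<in>G. g p = 0}"

definition J1 :: "(params \<Rightarrow> complex) set" where "J1 = {c001, a001}"
definition J4 :: "(params \<Rightarrow> complex) set" where "J4 = {b100, a100}"
definition J5 :: "(params \<Rightarrow> complex) set" where "J5 = {b100, a001}"
definition J8 :: "(params \<Rightarrow> complex) set" where "J8 = {c010, a001}"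
definition J9 :: "complex \<Rightarrow> (params \<Rightarrow> complex) set" where
  "J9 \<zeta> = {b100, \<lambda>p. a010 p - \<zeta> * c010 p}"

(* Near the origin h is the sum of a power series in three variables, with exponents
   alpha :: 3 => nat, all of whose terms have degree at least two.
   For complex families has_sum is absolute convergence. *)
definition convergent_ps_order_ge_2 :: "(complex^3 \<Rightarrow> complex^3) \<Rightarrow> bool" where
  "convergent_ps_order_ge_2 h \<longleftrightarrow>
     (\<exists>c :: (3 \<Rightarrow> nat) \<Rightarrow> complex^3.
        (\<forall>\<alpha>. (\<Sum>j\<in>UNIV. \<alpha> j) < 2 \<longrightarrow> c \<alpha> = 0) \<and>
        (\<forall>\<^sub>F y in nhds 0. \<forall>i.
           ((\<lambda>\<alpha>. c \<alpha> $ i * (\<Prod>j\<in>UNIV. (y $ j) ^ \<alpha> j)) has_sum h y $ i) UNIV))"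

(* The substitution x = H y turns x' = F x into y' = G y near the origin: by the chain rule
   x' = DH(y) y', so this is the identity DH(y) (G y) = F (H y). *)
definition transforms_near_0 ::
  "('a::real_normed_vector \<Rightarrow> 'a) \<Rightarrow> ('a \<Rightarrow> 'a) \<Rightarrow> ('a \<Rightarrow> 'a) \<Rightarrow> bool" where
  "transforms_near_0 H F G \<longleftrightarrow>
     (\<forall>\<^sub>F y in nhds 0. \<exists>D. (H has_derivative D) (at y) \<and> D (G y) = F (H y))"

lemma transforms_near_0_solutions:
  assumes "transforms_near_0 H F G"
  shows "\<exists>U. open U \<and> 0 \<in> U \<and>
    (\<forall>y t. y t \<in> U \<longrightarrow> (y has_vector_derivative G (y t)) (at t) \<longrightarrow>
       ((\<lambda>s. H (y s)) has_vector_derivative F (H (y t))) (at t))"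
proof -
  obtain U where U: "open U" "0 \<in> U"
    and D: "\<And>y. y \<in> U \<Longrightarrow> \<exists>D. (H has_derivative D) (at y) \<and> D (G y) = F (H y)"
    using assms unfolding transforms_near_0_def eventually_nhds by blast
  have "((\<lambda>s. H (y s)) has_vector_derivative F (H (y t))) (at t)"
    if "y t \<in> U" "(y has_vector_derivative G (y t)) (at t)" for y t
  proof -
    obtain D where D': "(H has_derivative D) (at (y t))" "D (G (y t)) = F (H (y t))"
      using D \<open>y t \<in> U\<close> by blast
    interpret D: linear D using D'(1) by (rule has_derivative_linear)
    from has_derivative_compose[OF that(2)[unfolded has_vector_derivative_def] D'(1)]
    show ?thesis by (simp add: has_vector_derivative_def D.scale D'(2))
  qed
  with U show ?thesis by blast
qed

(* Invertibility of y + h y near the origin is automatic, since its derivative at 0 is the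
   identity when h has order at least two. *)
definition linearizable :: "complex \<Rightarrow> (complex^3 \<Rightarrow> complex^3) \<Rightarrow> bool" where
  "linearizable \<zeta> F \<longleftrightarrow>
     (\<exists>h. convergent_ps_order_ge_2 h \<and>
          transforms_near_0 (\<lambda>y. y + h y) F (lin_field \<zeta>))"

end

theory Submission
  imports Defs "HOL-Library.Function_Algebras"
begin

text \<open>
  Write the system as \<open>x\<^sub>i' = x\<^sub>i (l\<^sub>i + (\<Sum>j. A\<^sub>i\<^sub>j x\<^sub>j))\<close> and look for \<open>x\<^sub>i = y\<^sub>i X\<^sub>i(y)\<close>. With \<open>L\<close> the derivation
  along the linear field, this asks for \<open>L X\<^sub>i = X\<^sub>i (\<Sum>j. A\<^sub>i\<^sub>j y\<^sub>j X\<^sub>j)\<close> and \<open>X\<^sub>i(0) = 1\<close>. On monomials \<open>L\<close>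
  is multiplication by \<open>\<alpha>\<^sub>1 + \<alpha>\<^sub>2 \<zeta> + \<alpha>\<^sub>3 \<zeta>\<^sup>2\<close>, an Eisenstein integer: it vanishes exactly if
  \<open>\<alpha>\<^sub>1 = \<alpha>\<^sub>2 = \<alpha>\<^sub>3\<close> and otherwise has modulus at least 1. Hence there are no small divisors, and
  after the rescaling \<open>z = y/r\<close> with small \<open>r\<close> the equation with all resonant terms discarded is solved
  by a contraction in the Banach algebra of absolutely summable power series.

  For \<open>J\<^sub>1\<close>, \<open>J\<^sub>4\<close>, \<open>J\<^sub>5\<close>, \<open>J\<^sub>8\<close> each \<open>X\<^sub>i\<close> misses one of the variables, so there was nothing to discard.
  For \<open>J\<^sub>9\<close> let \<open>X\<close> be the solution for the system with \<open>a\<^sub>1\<^sub>0\<^sub>0\<close> replaced by 0, which involves only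
  \<open>y\<^sub>2, y\<^sub>3\<close>. The first equation is of Bernoulli type, so \<open>X\<^sub>1\<close> is corrected to \<open>X\<^sub>1 / (1 - W)\<close> with
  \<open>L W = a\<^sub>1\<^sub>0\<^sub>0 y\<^sub>1 X\<^sub>1\<close>. The only possible resonance here is the coefficient of \<open>y\<^sub>2 y\<^sub>3\<close> in \<open>X\<^sub>1\<close>, which is
  \<open>a\<^sub>0\<^sub>0\<^sub>1 (a\<^sub>0\<^sub>1\<^sub>0 - \<zeta> c\<^sub>0\<^sub>1\<^sub>0)\<close>.
\<close>

section \<open>The Banach algebra of absolutely summable power series\<close>

no_notation Infinite_Set_Sum.abs_summable_on (infix "abs'_summable'_on" 50)

definition splits :: "('n \<Rightarrow> nat) \<Rightarrow> (('n \<Rightarrow> nat) \<times> ('n \<Rightarrow> nat)) set" where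
  "splits \<gamma> = {p. fst p + snd p = \<gamma>}"

lemma mem_splits [simp]: "p \<in> splits \<gamma> \<longleftrightarrow> fst p + snd p = \<gamma>"
  by (simp add: splits_def)

lemma finite_splits [simp]: "finite (splits (\<gamma> :: 'n::finite \<Rightarrow> nat))"
proof (rule finite_subset)
  let ?B = "{f :: 'n \<Rightarrow> nat. \<forall>x. (x \<in> UNIV \<longrightarrow> f x \<in> {..Max (range \<gamma>)}) \<and> (x \<notin> UNIV \<longrightarrow> f x = 0)}"
  have bd: "\<gamma> x \<le> Max (range \<gamma>)" for x
    by (rule Max_ge) auto
  show "splits \<gamma> \<subseteq> ?B \<times> ?B"
  proof
    fix p assume "p \<in> splits \<gamma>"
    hence "fst p x \<le> \<gamma> x \<and> snd p x \<le> \<gamma> x" for x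
      by auto
    hence "fst p x \<le> Max (range \<gamma>) \<and> snd p x \<le> Max (range \<gamma>)" for x
      using bd order_trans by blast
    thus "p \<in> ?B \<times> ?B"
      by (cases p) auto
  qed
  have "finite ?B"
    by (rule finite_set_of_finite_funs) auto
  thus "finite (?B \<times> ?B)"
    by (intro finite_cartesian_product)
qed

text \<open>Cauchy product theorem: the double family is absolutely summable, and its index set is
  the disjoint union of the finite sets \<open>splits \<gamma>\<close>. It is applied to norms of
  coefficients to bound products, and to evaluated terms to show that evaluation is
  multiplicative.\<close>

lemma convolution_has_sum:
  fixes F G :: "('n::finite \<Rightarrow> nat) \<Rightarrow> 'a::{real_normed_field,banach}"
  assumes F: "F abs_summable_on UNIV" and G: "G abs_summable_on UNIV"
  shows "((\<lambda>\<gamma>. \<Sum>p\<in>splits \<gamma>. F (fst p) * G (snd p)) has_sum (infsum F UNIV * infsum G UNIV)) UNIV"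
proof -
  let ?P = "\<lambda>p. F (fst p) * G (snd p)"
  have "?P abs_summable_on (UNIV \<times> UNIV)"
    unfolding Infinite_Sum.abs_summable_on_Sigma_iff
  proof (intro conjI ballI)
    fix x show "(\<lambda>y. ?P (x, y)) abs_summable_on UNIV"
      using G by (simp add: norm_mult summable_on_cmult_right)
  next
    have eq: "(\<Sum>\<^sub>\<infinity>y. norm (?P (x, y))) = norm (F x) * (\<Sum>\<^sub>\<infinity>y. norm (G y))" for x
      by (simp add: norm_mult infsum_cmult_right')
    show "(\<lambda>x. \<Sum>\<^sub>\<infinity>y. norm (?P (x, y))) abs_summable_on UNIV"
      unfolding eq using F by (simp add: abs_mult summable_on_cmult_left)
  qed
  hence sP: "?P summable_on (UNIV \<times> UNIV)"
    by (rule abs_summable_summable)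
  have "infsum ?P (UNIV \<times> UNIV) = infsum F UNIV * infsum G UNIV"
    using infsum_Sigma_banach[OF sP] by (simp add: infsum_cmult_right' infsum_cmult_left')
  with has_sum_infsum[OF sP] have P: "(?P has_sum (infsum F UNIV * infsum G UNIV)) UNIV"
    by simp
  have "((\<lambda>q. ?P (snd q)) has_sum (infsum F UNIV * infsum G UNIV)) (Sigma UNIV splits)
      \<longleftrightarrow> (?P has_sum (infsum F UNIV * infsum G UNIV)) UNIV"
    by (rule has_sum_reindex_bij_witness[where i = "\<lambda>p. (fst p + snd p, p)" and j = snd]) auto
  with P have S: "((\<lambda>q. ?P (snd q)) has_sum (infsum F UNIV * infsum G UNIV)) (Sigma UNIV splits)"
    by blast
  show ?thesis
    by (rule has_sum_Sigma[OF isUCont_plus S])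
       (auto intro: has_sum_finiteI)
qed

text \<open>These series converge absolutely on the closed unit polydisc. One fixed radius suffices,
  because smaller domains are reached by rescaling the variables.\<close>

typedef (overloaded) 'n lps = "{f :: ('n::finite \<Rightarrow> nat) \<Rightarrow> complex. f abs_summable_on UNIV}"
  morphisms coeff Abs_lps
  by (rule exI[of _ "\<lambda>_. 0"]) simp

setup_lifting type_definition_lps

lemma coeff_summable: "coeff f abs_summable_on UNIV"
  using coeff by blast

lemma lps_eqI: "(\<And>\<alpha>. coeff f \<alpha> = coeff g \<alpha>) \<Longrightarrow> f = g"
  by (simp add: coeff_inject[symmetric] fun_eq_iff)

section \<open>The Banach space structure\<close>

instantiation lps :: (finite) real_normed_vector
begin

lift_definition zero_lps :: "'a lps" is "\<lambda>_. 0" by simp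
lift_definition plus_lps :: "'a lps \<Rightarrow> 'a lps \<Rightarrow> 'a lps" is "\<lambda>f g \<alpha>. f \<alpha> + g \<alpha>"
  subgoal for f g
    by (rule Infinite_Sum.abs_summable_on_comparison_test'[where g = "\<lambda>\<alpha>. norm (f \<alpha>) + norm (g \<alpha>)"])
       (auto intro: norm_triangle_ineq summable_on_add)
  done
lift_definition uminus_lps :: "'a lps \<Rightarrow> 'a lps" is "\<lambda>f \<alpha>. - f \<alpha>" by simp
lift_definition minus_lps :: "'a lps \<Rightarrow> 'a lps \<Rightarrow> 'a lps" is "\<lambda>f g \<alpha>. f \<alpha> - g \<alpha>"
  subgoal for f g
    by (rule Infinite_Sum.abs_summable_on_comparison_test'[where g = "\<lambda>\<alpha>. norm (f \<alpha>) + norm (g \<alpha>)"])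
       (auto intro: norm_triangle_ineq4 summable_on_add)
  done
lift_definition scaleR_lps :: "real \<Rightarrow> 'a lps \<Rightarrow> 'a lps" is "\<lambda>c f \<alpha>. c *\<^sub>R f \<alpha>"
  by (auto intro: summable_on_cmult_right)
definition norm_lps :: "'a lps \<Rightarrow> real" where "norm_lps f = (\<Sum>\<^sub>\<infinity>\<alpha>. norm (coeff f \<alpha>))"
definition sgn_lps :: "'a lps \<Rightarrow> 'a lps" where "sgn_lps f = inverse (norm f) *\<^sub>R f"
definition dist_lps :: "'a lps \<Rightarrow> 'a lps \<Rightarrow> real" where "dist_lps f g = norm (f - g)"
definition uniformity_lps :: "('a lps \<times> 'a lps) filter" where
  "uniformity_lps = (INF e\<in>{0 <..}. principal {(x, y). dist x y < e})"
definition open_lps :: "'a lps set \<Rightarrow> bool" where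
  "open_lps U \<longleftrightarrow> (\<forall>x\<in>U. eventually (\<lambda>(x', y). x' = x \<longrightarrow> y \<in> U) uniformity)"

instance
proof
  fix f g h :: "'a lps" and a b :: real
  show "f + g + h = f + (g + h)" by transfer (simp add: fun_eq_iff)
  show "f + g = g + f" by transfer (simp add: fun_eq_iff)
  show "0 + f = f" by transfer simp
  show "- f + f = 0" by transfer simp
  show "f - g = f + - g" by transfer simp
  show "a *\<^sub>R (f + g) = a *\<^sub>R f + a *\<^sub>R g" by transfer (simp add: scaleR_add_right)
  show "(a + b) *\<^sub>R f = a *\<^sub>R f + b *\<^sub>R f" by transfer (simp add: scaleR_add_left)
  show "a *\<^sub>R b *\<^sub>R f = (a * b) *\<^sub>R f" by transfer simp
  show "1 *\<^sub>R f = f" by transfer simp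
  show "sgn f = inverse (norm f) *\<^sub>R f" by (rule sgn_lps_def)
  show "dist f g = norm (f - g)" by (rule dist_lps_def)
  show "norm (a *\<^sub>R f) = \<bar>a\<bar> * norm f"
    by (simp add: norm_lps_def scaleR_lps.rep_eq infsum_cmult_right')
  show "norm (f + g) \<le> norm f + norm g"
    unfolding norm_lps_def
    by (subst infsum_add[symmetric], (rule coeff_summable)+, rule infsum_mono, rule coeff_summable,
        intro summable_on_add coeff_summable) (simp add: plus_lps.rep_eq norm_triangle_ineq)
  show "(norm f = 0) = (f = 0)"
  proof
    assume "norm f = 0"
    hence "norm (coeff f \<alpha>) = 0" for \<alpha>
      by (intro nonneg_infsum_le_0D[OF _ coeff_summable[of f]]) (auto simp: norm_lps_def)
    thus "f = 0" by (intro lps_eqI) (simp add: zero_lps.rep_eq)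
  qed (simp add: norm_lps_def zero_lps.rep_eq)
qed (rule uniformity_lps_def open_lps_def)+

end

lemmas coeff_simps [simp] = zero_lps.rep_eq plus_lps.rep_eq uminus_lps.rep_eq minus_lps.rep_eq

lemma sum_coeff_le_norm: "finite F \<Longrightarrow> (\<Sum>\<alpha>\<in>F. norm (coeff f \<alpha>)) \<le> norm f"
  unfolding norm_lps_def by (rule finite_sum_le_infsum[OF coeff_summable]) auto

lemma norm_coeff_le: "norm (coeff f \<alpha>) \<le> norm f"
  using sum_coeff_le_norm[of "{\<alpha>}" f] by simp

lemma bounded_linear_coeff: "bounded_linear (\<lambda>f. coeff f \<alpha>)"
  by (rule bounded_linear_intro[where K = 1]) (auto simp: scaleR_lps.rep_eq norm_coeff_le)

text \<open>Bounds on finite partial sums survive coefficientwise limits and are easy to obtain for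
  products. They therefore serve both to construct series and to estimate their norms.\<close>

lemma lps_of_bounded_sums:
  assumes "\<And>F. finite F \<Longrightarrow> (\<Sum>\<alpha>\<in>F. norm (f \<alpha>)) \<le> B"
  obtains g where "coeff g = f" "norm g \<le> B"
proof -
  have "f abs_summable_on UNIV"
    unfolding abs_summable_iff_bdd_above using assms by (intro bdd_aboveI2) auto
  hence "coeff (Abs_lps f) = f" by (simp add: Abs_lps_inverse)
  moreover have "norm (Abs_lps f) \<le> B"
    unfolding norm_lps_def \<open>coeff (Abs_lps f) = f\<close>
    using \<open>f abs_summable_on UNIV\<close> assms by (intro infsum_le_finite_sums) auto
  ultimately show ?thesis using that by blast
qed

text \<open>Completeness is proved as for l1: the coefficients converge because the coefficient
  functionals are bounded, and the Cauchy estimate on finite sets of exponents passes to the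
  limit.\<close>

instance lps :: (finite) banach
proof
  fix X :: "nat \<Rightarrow> 'a lps" assume X: "Cauchy X"
  have "\<exists>l. (\<lambda>n. coeff (X n) \<alpha>) \<longlonglongrightarrow> l" for \<alpha>
    using bounded_linear.Cauchy[OF bounded_linear_coeff X]
    by (simp add: Cauchy_convergent_iff convergent_def)
  then obtain l where l: "\<And>\<alpha>. (\<lambda>n. coeff (X n) \<alpha>) \<longlonglongrightarrow> l \<alpha>" by metis
  have close: "(\<Sum>\<alpha>\<in>F. norm (l \<alpha> - coeff (X m) \<alpha>)) \<le> e"
    if m: "\<And>n. n \<ge> m \<Longrightarrow> norm (X n - X m) \<le> e" and "finite F" for m e F
  proof (rule tendsto_upperbound)
    show "(\<lambda>n. \<Sum>\<alpha>\<in>F. norm (coeff (X n) \<alpha> - coeff (X m) \<alpha>)) \<longlonglongrightarrow> (\<Sum>\<alpha>\<in>F. norm (l \<alpha> - coeff (X m) \<alpha>))"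
      by (intro tendsto_intros l)
    show "\<forall>\<^sub>F n in sequentially. (\<Sum>\<alpha>\<in>F. norm (coeff (X n) \<alpha> - coeff (X m) \<alpha>)) \<le> e"
    proof (rule eventually_sequentiallyI)
      fix n assume "n \<ge> m"
      thus "(\<Sum>\<alpha>\<in>F. norm (coeff (X n) \<alpha> - coeff (X m) \<alpha>)) \<le> e"
        using sum_coeff_le_norm[OF \<open>finite F\<close>, of "X n - X m"] m[of n] by simp
    qed
  qed simp
  have small: "\<exists>m. \<forall>n\<ge>m. norm (X n - X m) \<le> e" if "e > 0" for e
    using CauchyD[OF X that] by (blast intro: less_imp_le)
  obtain m where m: "\<And>n. n \<ge> m \<Longrightarrow> norm (X n - X m) \<le> 1" using small[of 1] by auto
  \<comment> \<open>The estimate controls only the difference between the limit and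
    \<open>X m\<close>, so the limit is assembled as \<open>X m + D\<close>.\<close>
  obtain D where D: "coeff D = (\<lambda>\<alpha>. l \<alpha> - coeff (X m) \<alpha>)"
    using lps_of_bounded_sums[OF close[OF m]] by blast
  define L where "L = X m + D"
  have L: "coeff L \<alpha> = l \<alpha>" for \<alpha> by (simp add: L_def D)
  have "X \<longlonglongrightarrow> L"
  proof (rule LIMSEQ_I)
    fix e :: real assume "e > 0"
    then obtain k where k: "\<And>n. n \<ge> k \<Longrightarrow> norm (X n - X k) \<le> e / 4" using small[of "e / 4"] by auto
    obtain E where E: "coeff E = (\<lambda>\<alpha>. l \<alpha> - coeff (X k) \<alpha>)" "norm E \<le> e / 4"
      using lps_of_bounded_sums[OF close[OF k]] by blast
    have "E = L - X k" by (rule lps_eqI) (simp add: E L)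
    with E have "norm (X n - L) < e" if "n \<ge> k" for n
      using k[OF that] norm_triangle_ineq4[of "X n - X k" E] \<open>e > 0\<close> by simp
    thus "\<exists>k. \<forall>n\<ge>k. norm (X n - L) < e" by blast
  qed
  thus "convergent X" by (rule convergentI)
qed

text \<open>This gives at once that the Cauchy product is summable and that the norm is
  submultiplicative.\<close>

lemma convolution_bound:
  fixes f g :: "'n::finite lps"
  assumes "finite F"
  shows "(\<Sum>\<gamma>\<in>F. norm (\<Sum>p\<in>splits \<gamma>. coeff f (fst p) * coeff g (snd p))) \<le> norm f * norm g"
proof -
  have "(\<Sum>\<gamma>\<in>F. norm (\<Sum>p\<in>splits \<gamma>. coeff f (fst p) * coeff g (snd p)))
      \<le> (\<Sum>\<gamma>\<in>F. \<Sum>p\<in>splits \<gamma>. norm (coeff f (fst p)) * norm (coeff g (snd p)))"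
    by (intro sum_mono order_trans[OF norm_sum]) (simp add: norm_mult)
  also have "\<dots> \<le> norm f * norm g"
    unfolding norm_lps_def
    by (rule finite_sum_le_has_sum[OF convolution_has_sum])
       (use assms coeff_summable[of f] coeff_summable[of g] in \<open>auto intro!: sum_nonneg\<close>)
  finally show ?thesis .
qed

section \<open>The Cauchy product as multiplication\<close>

instantiation lps :: (finite) real_normed_algebra_1
begin

lift_definition one_lps :: "'a lps" is "\<lambda>\<alpha>. if \<alpha> = 0 then 1 else 0"
  by (rule finite_nonzero_values_imp_summable_on) simp

lift_definition times_lps :: "'a lps \<Rightarrow> 'a lps \<Rightarrow> 'a lps" is
  "\<lambda>f g \<gamma>. \<Sum>p\<in>splits \<gamma>. f (fst p) * g (snd p)"
proof -
  fix f g :: "('a \<Rightarrow> nat) \<Rightarrow> complex"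
  assume "f abs_summable_on UNIV" "g abs_summable_on UNIV"
  then obtain f' g' where "f = coeff f'" "g = coeff g'" by (metis Abs_lps_inverse mem_Collect_eq)
  moreover obtain h where "coeff h = (\<lambda>\<gamma>. \<Sum>p\<in>splits \<gamma>. coeff f' (fst p) * coeff g' (snd p))"
    by (rule lps_of_bounded_sums[OF convolution_bound[of _ f' g']])
  ultimately show "(\<lambda>\<gamma>. \<Sum>p\<in>splits \<gamma>. f (fst p) * g (snd p)) abs_summable_on UNIV"
    using coeff_summable[of h] by simp
qed

instance
proof
  fix f g h :: "'a lps" and a :: real
  show "f * g * h = f * (g * h)"
  proof (rule lps_eqI)
    fix \<gamma>
    let ?t = "\<lambda>a b c. coeff f a * coeff g b * coeff h c"
    have "coeff (f * g * h) \<gamma> = (\<Sum>(p, q)\<in>Sigma (splits \<gamma>) (\<lambda>p. splits (fst p)). ?t (fst q) (snd q) (snd p))"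
      unfolding times_lps.rep_eq sum_distrib_right by (subst sum.Sigma) auto
    also have "\<dots> = (\<Sum>(p, q)\<in>Sigma (splits \<gamma>) (\<lambda>p. splits (snd p)). ?t (fst p) (fst q) (snd q))"
      \<comment> \<open>Both sums run over triples of exponents with sum \<open>\<gamma>\<close>;
        the witnesses rebracket \<open>((a, b), c)\<close> and \<open>(a, (b, c))\<close>.\<close>
      by (rule sum.reindex_bij_witness[where
            i = "\<lambda>(p, q). ((fst p + fst q, snd q), (fst p, fst q))" and
            j = "\<lambda>(p, q). ((fst q, snd q + snd p), (snd q, snd p))"])
         (auto simp: add.assoc)
    also have "\<dots> = coeff (f * (g * h)) \<gamma>"
      unfolding times_lps.rep_eq sum_distrib_left mult.assoc by (subst sum.Sigma) auto
    finally show "coeff (f * g * h) \<gamma> = coeff (f * (g * h)) \<gamma>" .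
  qed
  show "1 * f = f"
  proof (rule lps_eqI)
    fix \<gamma>
    have "coeff (1 * f) \<gamma> = (\<Sum>p\<in>{(0 :: 'a \<Rightarrow> nat, \<gamma>)}. (if fst p = 0 then 1 else 0) * coeff f (snd p))"
      unfolding times_lps.rep_eq one_lps.rep_eq
      by (rule sum.mono_neutral_right) auto
    thus "coeff (1 * f) \<gamma> = coeff f \<gamma>" by simp
  qed
  show "f * 1 = f"
  proof (rule lps_eqI)
    fix \<gamma>
    have "coeff (f * 1) \<gamma> = (\<Sum>p\<in>{(\<gamma>, 0 :: 'a \<Rightarrow> nat)}. coeff f (fst p) * (if snd p = 0 then 1 else 0))"
      unfolding times_lps.rep_eq one_lps.rep_eq
      by (rule sum.mono_neutral_right) auto
    thus "coeff (f * 1) \<gamma> = coeff f \<gamma>" by simp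
  qed
  show "(f + g) * h = f * h + g * h"
    by (rule lps_eqI) (simp add: times_lps.rep_eq distrib_right sum.distrib)
  show "f * (g + h) = f * g + f * h"
    by (rule lps_eqI) (simp add: times_lps.rep_eq distrib_left sum.distrib)
  show "a *\<^sub>R f * g = a *\<^sub>R (f * g)"
    by (rule lps_eqI) (simp add: times_lps.rep_eq scaleR_lps.rep_eq scaleR_sum_right)
  show "f * a *\<^sub>R g = a *\<^sub>R (f * g)"
    by (rule lps_eqI) (simp add: times_lps.rep_eq scaleR_lps.rep_eq scaleR_sum_right)
  have "coeff (0 :: 'a lps) 0 \<noteq> coeff 1 0" by (simp add: one_lps.rep_eq)
  thus "(0 :: 'a lps) \<noteq> 1" by metis
  obtain k where k: "coeff k = (\<lambda>\<gamma>. \<Sum>p\<in>splits \<gamma>. coeff f (fst p) * coeff g (snd p))"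
    and le: "norm k \<le> norm f * norm g"
    by (rule lps_of_bounded_sums[OF convolution_bound[of _ f g]])
  have "k = f * g" by (rule lps_eqI) (simp add: k times_lps.rep_eq)
  with le show "norm (f * g) \<le> norm f * norm g" by simp
  have "((\<lambda>\<alpha>. norm (coeff (1 :: 'a lps) \<alpha>)) has_sum 1) UNIV"
    by (rule has_sum_finite_neutralI[where B = "{0}"]) (auto simp: one_lps.rep_eq)
  thus "norm (1 :: 'a lps) = 1"
    unfolding norm_lps_def by (rule infsumI)
qed

end

lift_definition monomial :: "('n::finite \<Rightarrow> nat) \<Rightarrow> complex \<Rightarrow> 'n lps" is
  "\<lambda>\<alpha> c \<beta>. if \<beta> = \<alpha> then c else 0"
  by (rule finite_nonzero_values_imp_summable_on) simp

lemma norm_monomial [simp]: "norm (monomial \<alpha> c) = norm c"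
proof -
  have "((\<lambda>\<beta>. norm (coeff (monomial \<alpha> c) \<beta>)) has_sum norm c) UNIV"
    by (rule has_sum_finite_neutralI[where B = "{\<alpha>}"]) (auto simp: monomial.rep_eq)
  thus ?thesis unfolding norm_lps_def by (rule infsumI)
qed

lemma coeff_monomial_mult:
  "coeff (monomial \<alpha> c * f) \<gamma> = (if \<alpha> \<le> \<gamma> then c * coeff f (\<gamma> - \<alpha>) else 0)"
proof (cases "\<alpha> \<le> \<gamma>")
  case True
  hence eq: "\<alpha> + (\<gamma> - \<alpha>) = \<gamma>" by (auto simp: fun_eq_iff le_fun_def)
  have "coeff (monomial \<alpha> c * f) \<gamma>
      = (\<Sum>p\<in>{(\<alpha>, \<gamma> - \<alpha>)}. (if fst p = \<alpha> then c else 0) * coeff f (snd p))"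
    unfolding times_lps.rep_eq monomial.rep_eq
    by (rule sum.mono_neutral_right) (use eq in auto)
  thus ?thesis using True by simp
next
  case False
  hence "fst p \<noteq> \<alpha>" if "p \<in> splits \<gamma>" for p using that by (auto simp: le_fun_def)
  thus ?thesis using False by (auto simp: times_lps.rep_eq monomial.rep_eq intro!: sum.neutral)
qed

section \<open>Evaluation and differentiation\<close>

lemma norm_le_sum_norm_nth: "norm (x :: 'a::real_normed_vector^'n) \<le> (\<Sum>i\<in>UNIV. norm (x $ i))"
  unfolding norm_vec_def by (rule L2_set_le_sum) simp

text \<open>A vector is the finite sum of its coordinates embedded by \<open>axis i\<close>, and
  these embeddings are bounded linear.\<close>

lemma has_derivative_vec:
  fixes f :: "'a::real_normed_vector \<Rightarrow> 'b::real_normed_vector^'n"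
  assumes "\<And>i. ((\<lambda>x. f x $ i) has_derivative (\<lambda>h. D h $ i)) F"
  shows "(f has_derivative D) F"
proof -
  have eq: "x = (\<Sum>i\<in>UNIV. axis i (x $ i))" for x :: "'b^'n"
    by (simp add: vec_eq_iff axis_def if_distrib cong: if_cong)
  have bl: "bounded_linear (axis i :: 'b \<Rightarrow> 'b^'n)" for i
  proof (rule bounded_linear_intro[where K = 1])
    fix x y :: 'b and c :: real
    show "axis i (x + y) = axis i x + axis i y" "axis i (c *\<^sub>R x) = c *\<^sub>R axis i x"
      by (simp_all add: vec_eq_iff axis_def)
    show "norm (axis i x) \<le> norm x * 1"
      using norm_le_sum_norm_nth[of "axis i x"] by (simp add: axis_def if_distrib cong: if_cong)
  qed
  have "((\<lambda>x. \<Sum>i\<in>UNIV. axis i (f x $ i)) has_derivative (\<lambda>h. \<Sum>i\<in>UNIV. axis i (D h $ i))) F"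
    by (intro has_derivative_sum bounded_linear.has_derivative[OF bl] assms)
  thus ?thesis by (simp flip: eq)
qed

section \<open>Monomials and evaluation on the closed unit ball\<close>

definition zpow :: "complex^'n \<Rightarrow> ('n::finite \<Rightarrow> nat) \<Rightarrow> complex" where
  "zpow z \<alpha> = (\<Prod>j\<in>UNIV. (z $ j) ^ \<alpha> j)"

lemma zpow_add: "zpow z (\<alpha> + \<beta>) = zpow z \<alpha> * zpow z \<beta>"
  by (simp add: zpow_def power_add prod.distrib)

lemma zpow_0 [simp]: "zpow z 0 = 1"
  by (simp add: zpow_def)

lemma zpow_scaleR: "zpow (c *\<^sub>R z) \<alpha> = complex_of_real c ^ (\<Sum>j\<in>UNIV. \<alpha> j) * zpow z \<alpha>"
proof -
  have "(c *\<^sub>R z) $ j = complex_of_real c * z $ j" for j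
    by (simp only: vector_scaleR_component) (simp add: scaleR_conv_of_real)
  thus ?thesis
    by (simp only: zpow_def power_mult_distrib prod.distrib power_sum)
qed

text \<open>The Euclidean unit ball lies in the unit polydisc, so the terms of an evaluated series
  are dominated by its coefficients.\<close>

lemma norm_zpow_le_1:
  assumes "norm z \<le> 1"
  shows "norm (zpow z \<alpha>) \<le> 1"
proof -
  have zi: "norm (z $ i) \<le> 1" for i
    using order_trans[OF Finite_Cartesian_Product.norm_nth_le assms] .
  have "norm (zpow z \<alpha>) = (\<Prod>j\<in>UNIV. norm (z $ j) ^ \<alpha> j)"
    by (simp add: zpow_def norm_power flip: prod_norm)
  also have "\<dots> \<le> 1"
    by (rule prod_le_1) (simp add: zi power_le_one)
  finally show ?thesis .
qed

definition eval :: "complex^'n \<Rightarrow> 'n::finite lps \<Rightarrow> complex" where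
  "eval z f = (\<Sum>\<^sub>\<infinity>\<alpha>. coeff f \<alpha> * zpow z \<alpha>)"

context
  fixes z :: "complex^'n::finite"
  assumes z: "norm z \<le> 1"
begin

lemma norm_term_le: "norm (coeff f \<alpha> * zpow z \<alpha>) \<le> norm (coeff f \<alpha>)"
  using norm_zpow_le_1[OF z] by (simp add: norm_mult mult_left_le)

lemma eval_abs_summable: "(\<lambda>\<alpha>. coeff f \<alpha> * zpow z \<alpha>) abs_summable_on UNIV"
  using coeff_summable by (rule Infinite_Sum.abs_summable_on_comparison_test) (rule norm_term_le)

lemma eval_has_sum: "((\<lambda>\<alpha>. coeff f \<alpha> * zpow z \<alpha>) has_sum eval z f) UNIV"
  unfolding eval_def by (rule has_sum_infsum[OF abs_summable_summable[OF eval_abs_summable]])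

lemma norm_eval_le: "norm (eval z f) \<le> norm f"
  unfolding norm_lps_def
  by (rule norm_infsum_le[OF eval_has_sum has_sum_infsum[OF coeff_summable] norm_term_le])

lemma bounded_linear_eval: "bounded_linear (eval z)"
proof (rule bounded_linear_intro[where K = 1])
  fix f g :: "'n lps" and c :: real
  have "((\<lambda>\<alpha>. coeff (f + g) \<alpha> * zpow z \<alpha>) has_sum (eval z f + eval z g)) UNIV"
    using has_sum_add[OF eval_has_sum[of f] eval_has_sum[of g]] by (simp add: distrib_right)
  thus "eval z (f + g) = eval z f + eval z g"
    by (rule has_sum_unique[OF eval_has_sum])
  have "((\<lambda>\<alpha>. coeff (c *\<^sub>R f) \<alpha> * zpow z \<alpha>) has_sum (c *\<^sub>R eval z f)) UNIV"
    using has_sum_scaleR[OF eval_has_sum[of f]] by (simp add: scaleR_lps.rep_eq)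
  thus "eval z (c *\<^sub>R f) = c *\<^sub>R eval z f"
    by (rule has_sum_unique[OF eval_has_sum])
  show "norm (eval z f) \<le> norm f * 1"
    using norm_eval_le by simp
qed

lemma eval_mult: "eval z (f * g) = eval z f * eval z g"
proof -
  have "((\<lambda>\<gamma>. \<Sum>p\<in>splits \<gamma>. (coeff f (fst p) * zpow z (fst p)) * (coeff g (snd p) * zpow z (snd p)))
      has_sum (eval z f * eval z g)) UNIV"
    unfolding eval_def by (intro convolution_has_sum eval_abs_summable)
  also have "(\<lambda>\<gamma>. \<Sum>p\<in>splits \<gamma>. (coeff f (fst p) * zpow z (fst p)) * (coeff g (snd p) * zpow z (snd p)))
      = (\<lambda>\<gamma>. coeff (f * g) \<gamma> * zpow z \<gamma>)"
  proof
    fix \<gamma>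
    have "zpow z \<gamma> = zpow z (fst p) * zpow z (snd p)" if "p \<in> splits \<gamma>" for p
      using that zpow_add[of z "fst p" "snd p"] by (simp only: mem_splits)
    thus "(\<Sum>p\<in>splits \<gamma>. (coeff f (fst p) * zpow z (fst p)) * (coeff g (snd p) * zpow z (snd p)))
        = coeff (f * g) \<gamma> * zpow z \<gamma>"
      unfolding times_lps.rep_eq sum_distrib_right by (intro sum.cong) (simp_all del: mem_splits)
  qed
  finally show ?thesis
    by (rule has_sum_unique[OF eval_has_sum])
qed

lemma eval_monomial: "eval z (monomial \<alpha> c) = c * zpow z \<alpha>"
  by (rule has_sum_unique[OF eval_has_sum], rule has_sum_finite_neutralI[where B = "{\<alpha>}"])
     (auto simp: monomial.rep_eq)

lemma eval_1: "eval z 1 = 1"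
  by (rule has_sum_unique[OF eval_has_sum], rule has_sum_finite_neutralI[where B = "{0}"])
     (auto simp: one_lps.rep_eq)

lemmas eval_diff = bounded_linear.linear[OF bounded_linear_eval, THEN linear_diff]
lemmas eval_sum = bounded_linear.linear[OF bounded_linear_eval, THEN linear_sum]

lemma eval_power: "eval z (f ^ n) = eval z f ^ n"
  by (induction n) (simp_all add: eval_1 eval_mult)

text \<open>Evaluation is continuous, linear and multiplicative, so it carries the Neumann series to
  a scalar geometric series. This realizes the Bernoulli denominator \<open>1 - W\<close> by an
  element of the algebra.\<close>

lemma eval_geometric:
  assumes "norm f < 1"
  shows "eval z (\<Sum>n. f ^ n) = 1 / (1 - eval z f)"
proof -
  have "eval z (\<Sum>n. f ^ n) = (\<Sum>n. eval z f ^ n)"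
    using bounded_linear.suminf[OF bounded_linear_eval complete_algebra_summable_geometric[OF assms]]
    by (simp add: eval_power)
  also have "\<dots> = 1 / (1 - eval z f)"
    using norm_eval_le[of f] assms by (intro suminf_geometric) simp
  finally show ?thesis .
qed

end

lemma eval_at_0: "eval 0 f = coeff f 0"
proof -
  have "zpow 0 \<alpha> = 0" if "\<alpha> \<noteq> 0" for \<alpha> :: "'a \<Rightarrow> nat"
    using that by (auto simp: zpow_def fun_eq_iff)
  hence "((\<lambda>\<alpha>. coeff f \<alpha> * zpow 0 \<alpha>) has_sum coeff f 0) UNIV"
    by (intro has_sum_finite_neutralI[where B = "{0}"]) auto
  thus ?thesis by (rule has_sum_unique[OF eval_has_sum, rotated]) simp
qed

lemma coeff_mult_0: "coeff (f * g) 0 = coeff f 0 * coeff g 0"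
  by (simp add: eval_mult flip: eval_at_0)

section \<open>Termwise differentiation\<close>

definition zpow_deriv :: "('n::finite \<Rightarrow> nat) \<Rightarrow> complex^'n \<Rightarrow> complex^'n \<Rightarrow> complex" where
  "zpow_deriv \<alpha> z h = (\<Sum>i\<in>UNIV. (of_nat (\<alpha> i) * h $ i * (z $ i) ^ (\<alpha> i - 1)) * (\<Prod>j\<in>UNIV - {i}. (z $ j) ^ \<alpha> j))"

lemma zpow_has_derivative: "((\<lambda>z. zpow z \<alpha>) has_derivative zpow_deriv \<alpha> z) (at z within S)"
  unfolding zpow_def zpow_deriv_def[abs_def]
  by (intro has_derivative_prod has_derivative_power bounded_linear_imp_has_derivative bounded_linear_vec_nth)

text \<open>Each of the first \<open>n\<close> powers of \<open>\<rho>\<close> is at least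
  \<open>\<rho> ^ (n - 1)\<close>, so the geometric series bounds \<open>n\<close> copies of the
  latter.\<close>

lemma mult_power_pred_le:
  fixes \<rho> :: real
  assumes "0 \<le> \<rho>" "\<rho> < 1"
  shows "real n * \<rho> ^ (n - 1) \<le> 1 / (1 - \<rho>)"
proof -
  have "real n * \<rho> ^ (n - 1) = (\<Sum>k<n. \<rho> ^ (n - 1))" by simp
  also have "\<dots> \<le> (\<Sum>k<n. \<rho> ^ k)"
    using assms by (intro sum_mono power_decreasing) auto
  also have "\<dots> \<le> (\<Sum>k. \<rho> ^ k)"
    using assms by (intro sum_le_suminf summable_geometric) auto
  also have "\<dots> = 1 / (1 - \<rho>)"
    using assms by (intro suminf_geometric) auto
  finally show ?thesis .
qed

text \<open>The bound is uniform in \<open>\<alpha>\<close>, so on a ball of radius below 1 the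
  differentiated series is dominated by the coefficients.\<close>

lemma norm_zpow_deriv_le:
  fixes z h :: "complex^'n::finite"
  assumes "norm z \<le> \<rho>" "\<rho> < 1"
  shows "norm (zpow_deriv \<alpha> z h) \<le> real CARD('n) / (1 - \<rho>) * norm h"
proof -
  have \<rho>: "0 \<le> \<rho>" using assms(1) norm_ge_zero order_trans by blast
  have zi: "norm (z $ i) \<le> \<rho>" for i
    using order_trans[OF Finite_Cartesian_Product.norm_nth_le assms(1)] .
  have "norm (zpow_deriv \<alpha> z h) \<le> (\<Sum>i\<in>(UNIV :: 'n set). 1 / (1 - \<rho>) * norm h)"
    unfolding zpow_deriv_def
  proof (rule sum_norm_le)
    fix i
    have 1: "norm (\<Prod>j\<in>UNIV - {i}. (z $ j) ^ \<alpha> j) \<le> 1"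
    proof -
      have "norm (z $ j) \<le> 1" for j
        using order_trans[OF zi less_imp_le[OF assms(2)]] .
      thus ?thesis
        by (auto simp: norm_power power_le_one simp flip: prod_norm intro!: prod_le_1)
    qed
    have "norm (of_nat (\<alpha> i) * (z $ i) ^ (\<alpha> i - 1)) \<le> real (\<alpha> i) * \<rho> ^ (\<alpha> i - 1)"
      using zi by (auto simp: norm_mult norm_power intro!: mult_left_mono power_mono)
    also have "\<dots> \<le> 1 / (1 - \<rho>)"
      by (rule mult_power_pred_le[OF \<rho> assms(2)])
    finally have 2: "norm (of_nat (\<alpha> i) * (z $ i) ^ (\<alpha> i - 1)) \<le> 1 / (1 - \<rho>)" .
    have "norm (of_nat (\<alpha> i) * h $ i * (z $ i) ^ (\<alpha> i - 1) * (\<Prod>j\<in>UNIV - {i}. (z $ j) ^ \<alpha> j))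
        = norm (of_nat (\<alpha> i) * (z $ i) ^ (\<alpha> i - 1)) * norm (h $ i) * norm (\<Prod>j\<in>UNIV - {i}. (z $ j) ^ \<alpha> j)"
      by (simp add: norm_mult)
    also have "\<dots> \<le> (1 / (1 - \<rho>)) * norm h * 1"
      using 1 2 assms(2) by (intro mult_mono Finite_Cartesian_Product.norm_nth_le mult_nonneg_nonneg) auto
    finally show "norm (of_nat (\<alpha> i) * h $ i * (z $ i) ^ (\<alpha> i - 1) * (\<Prod>j\<in>UNIV - {i}. (z $ j) ^ \<alpha> j))
        \<le> 1 / (1 - \<rho>) * norm h" by simp
  qed
  thus ?thesis by simp
qed

text \<open>The differentiated series converges uniformly near \<open>z\<close>. The exponents are
  enumerated by a bijection \<open>e\<close> from the naturals, because
  \<open>has_derivative_series\<close> works with sequences of partial sums.\<close>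

lemma eval_has_derivative:
  fixes z :: "complex^'n::finite"
  assumes z: "norm z < 1"
  shows "((\<lambda>z. eval z f) has_derivative (\<lambda>h. \<Sum>\<^sub>\<infinity>\<alpha>. coeff f \<alpha> * zpow_deriv \<alpha> z h)) (at z)"
proof -
  \<comment> \<open>The midpoint leaves room on both sides: \<open>z\<close> is interior to the ball
    of radius \<open>\<rho>\<close>, and the derivative bounds stay finite there.\<close>
  define \<rho> where "\<rho> = (1 + norm z) / 2"
  have \<rho>: "norm z < \<rho>" "\<rho> < 1" using z by (auto simp: \<rho>_def)
  let ?S = "ball 0 \<rho> :: (complex^'n) set"
  define e :: "nat \<Rightarrow> ('n \<Rightarrow> nat)" where "e = from_nat_into UNIV"
  have "infinite (UNIV :: ('n \<Rightarrow> nat) set)"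
    by (rule infinite_super[OF subset_UNIV range_inj_infinite[of "\<lambda>n _. n"]]) (auto simp: inj_def fun_eq_iff)
  hence e: "bij e"
    unfolding e_def by (intro bij_betw_from_nat_into) auto
  have sums: "(\<lambda>n. g (e n)) sums s" if "(g has_sum s) UNIV" for g s
    using that by (intro has_sum_imp_sums) (subst has_sum_reindex_bij_betw[OF e])
  define K where "K = real CARD('n) / (1 - \<rho>)"
  have K: "0 \<le> K" using \<rho> by (simp add: K_def)
  have bd: "norm (coeff f \<alpha> * zpow_deriv \<alpha> x h) \<le> norm (coeff f \<alpha>) * (K * norm h)" if "x \<in> ?S" for x h \<alpha>
    using norm_zpow_deriv_le[of x \<rho> \<alpha> h] that \<rho> unfolding K_def norm_mult
    by (intro mult_left_mono) auto
  have d_sums: "(\<lambda>n. coeff f (e n) * zpow_deriv (e n) x h) sums (\<Sum>\<^sub>\<infinity>\<alpha>. coeff f \<alpha> * zpow_deriv \<alpha> x h)"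
    if "x \<in> ?S" for x h
  proof (rule sums[OF has_sum_infsum[OF abs_summable_summable]])
    show "(\<lambda>\<alpha>. coeff f \<alpha> * zpow_deriv \<alpha> x h) abs_summable_on UNIV"
      by (rule Infinite_Sum.abs_summable_on_comparison_test'[OF summable_on_cmult_left[OF coeff_summable] bd[OF that]])
  qed
  define b where "b n = norm (coeff f (e n))" for n
  have b: "summable b"
    unfolding b_def using sums[OF has_sum_infsum[OF coeff_summable]] by (rule sums_summable)
  \<comment> \<open>The remainder is at most a factor independent of \<open>x\<close> times
    \<open>norm h\<close>, and that factor tends to 0; this is the required uniform
    convergence.\<close>
  have tail: "norm ((\<Sum>i<n. coeff f (e i) * zpow_deriv (e i) x h) - (\<Sum>\<^sub>\<infinity>\<alpha>. coeff f \<alpha> * zpow_deriv \<alpha> x h))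
      \<le> (suminf b - (\<Sum>i<n. b i)) * (K * norm h)" if "x \<in> ?S" for n x h
  proof -
    let ?a = "\<lambda>i. coeff f (e i) * zpow_deriv (e i) x h"
    have shift: "summable (\<lambda>i. b (i + n))"
      using b by (simp only: summable_iff_shift)
    have "norm (\<Sum>i. ?a (i + n)) \<le> (\<Sum>i. b (i + n) * (K * norm h))"
      by (intro norm_suminf_le summable_mult2 shift) (simp only: b_def bd[OF that])
    also have "\<dots> = (suminf b - (\<Sum>i<n. b i)) * (K * norm h)"
      using suminf_mult2[OF shift] suminf_minus_initial_segment[OF b] by simp
    also have "(\<Sum>i. ?a (i + n)) = (\<Sum>\<^sub>\<infinity>\<alpha>. coeff f \<alpha> * zpow_deriv \<alpha> x h) - (\<Sum>i<n. ?a i)"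
      using suminf_minus_initial_segment[OF sums_summable[OF d_sums[OF that]]] sums_unique[OF d_sums[OF that]]
      by simp
    finally show ?thesis by (simp add: norm_minus_commute)
  qed
  have ev_sums: "(\<lambda>n. coeff f (e n) * zpow x (e n)) sums eval x f" if "x \<in> ?S" for x
    by (rule sums[OF eval_has_sum]) (use that \<rho> in simp)
  have "\<exists>g. \<forall>x\<in>?S. (\<lambda>n. coeff f (e n) * zpow x (e n)) sums g x \<and>
      (g has_derivative (\<lambda>h. \<Sum>\<^sub>\<infinity>\<alpha>. coeff f \<alpha> * zpow_deriv \<alpha> x h)) (at x within ?S)"
  proof (rule has_derivative_series[where f' = "\<lambda>n x h. coeff f (e n) * zpow_deriv (e n) x h" and x = z and l = "eval z f"])
    show "convex ?S" by (rule convex_ball)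
    show "z \<in> ?S" using \<rho> by simp
    thus "(\<lambda>n. coeff f (e n) * zpow z (e n)) sums eval z f" by (rule ev_sums)
    show "((\<lambda>x. coeff f (e n) * zpow x (e n)) has_derivative (\<lambda>h. coeff f (e n) * zpow_deriv (e n) x h))
        (at x within ?S)" for n x
      by (intro has_derivative_mult_right zpow_has_derivative)
    fix \<epsilon> :: real assume "\<epsilon> > 0"
    have "(\<lambda>n. (suminf b - (\<Sum>i<n. b i)) * K) \<longlonglongrightarrow> (suminf b - suminf b) * K"
      by (intro tendsto_intros summable_LIMSEQ b)
    hence "\<forall>\<^sub>F n in sequentially. (suminf b - (\<Sum>i<n. b i)) * K < \<epsilon>"
      using \<open>\<epsilon> > 0\<close> by (intro order_tendstoD) auto
    thus "\<forall>\<^sub>F n in sequentially. \<forall>x\<in>?S. \<forall>h.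
        norm ((\<Sum>i<n. coeff f (e i) * zpow_deriv (e i) x h) - (\<Sum>\<^sub>\<infinity>\<alpha>. coeff f \<alpha> * zpow_deriv \<alpha> x h)) \<le> \<epsilon> * norm h"
    proof (eventually_elim, intro ballI allI)
      fix n and x h :: "complex^'n" assume n: "(suminf b - (\<Sum>i<n. b i)) * K < \<epsilon>" and x: "x \<in> ?S"
      have "(suminf b - (\<Sum>i<n. b i)) * (K * norm h) \<le> \<epsilon> * norm h"
        using mult_right_mono[OF less_imp_le[OF n] norm_ge_zero[of h]] by (simp add: mult.assoc)
      thus "norm ((\<Sum>i<n. coeff f (e i) * zpow_deriv (e i) x h) - (\<Sum>\<^sub>\<infinity>\<alpha>. coeff f \<alpha> * zpow_deriv \<alpha> x h)) \<le> \<epsilon> * norm h"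
        by (rule order_trans[OF tail[OF x]])
    qed
  qed
  moreover have zS: "z \<in> ?S" using \<rho> by simp
  ultimately obtain g where g: "\<And>x. x \<in> ?S \<Longrightarrow> (\<lambda>n. coeff f (e n) * zpow x (e n)) sums g x"
    and g': "(g has_derivative (\<lambda>h. \<Sum>\<^sub>\<infinity>\<alpha>. coeff f \<alpha> * zpow_deriv \<alpha> z h)) (at z within ?S)"
    by blast
  have "g x = eval x f" if "x \<in> ?S" for x
    using g[OF that] ev_sums[OF that] by (rule sums_unique2)
  moreover have "(g has_derivative (\<lambda>h. \<Sum>\<^sub>\<infinity>\<alpha>. coeff f \<alpha> * zpow_deriv \<alpha> z h)) (at z)"
    using g' by (simp only: at_within_open[OF zS open_ball])
  ultimately show ?thesis
    using zS by (blast intro: has_derivative_transform_within_open[OF _ open_ball])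
qed

section \<open>Lie derivatives along a diagonal linear field\<close>

definition weight :: "complex^'n \<Rightarrow> ('n::finite \<Rightarrow> nat) \<Rightarrow> complex" where
  "weight l \<alpha> = (\<Sum>j\<in>UNIV. of_nat (\<alpha> j) * l $ j)"

definition diag_field :: "complex^'n \<Rightarrow> complex^'n \<Rightarrow> complex^'n::finite" where
  "diag_field l z = (\<chi> i. l $ i * z $ i)"

definition has_lie_derivative ::
  "(complex^'n \<Rightarrow> complex) \<Rightarrow> complex^'n \<Rightarrow> complex^'n::finite \<Rightarrow> complex \<Rightarrow> bool" where
  "has_lie_derivative f l z d \<longleftrightarrow> (\<exists>D. (f has_derivative D) (at z) \<and> D (diag_field l z) = d)"

text \<open>Euler identity: monomials are eigenfunctions of the derivation along
  \<open>diag_field l\<close>, with the weights as eigenvalues.\<close>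

lemma zpow_deriv_diag_field: "zpow_deriv \<alpha> z (diag_field l z) = weight l \<alpha> * zpow z \<alpha>"
proof -
  have "of_nat (\<alpha> i) * (l $ i * z $ i) * (z $ i) ^ (\<alpha> i - 1) * (\<Prod>j\<in>UNIV - {i}. (z $ j) ^ \<alpha> j)
      = of_nat (\<alpha> i) * l $ i * zpow z \<alpha>" for i
  proof -
    \<comment> \<open>The factor \<open>z $ i\<close> restores the lowered exponent; if
      \<open>\<alpha> i = 0\<close>, the subtraction is truncated but both sides vanish.\<close>
    have "of_nat (\<alpha> i) * (l $ i * z $ i) * (z $ i) ^ (\<alpha> i - 1) = of_nat (\<alpha> i) * l $ i * (z $ i) ^ \<alpha> i"
      by (cases "\<alpha> i") simp_all
    thus ?thesis
      unfolding zpow_def prod.remove[OF finite UNIV_I, of "\<lambda>j. (z $ j) ^ \<alpha> j" i]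
      by (simp only: mult.assoc[symmetric])
  qed
  thus ?thesis by (simp only: zpow_deriv_def diag_field_def weight_def vec_lambda_beta sum_distrib_right)
qed

text \<open>The series \<open>q\<close> is supplied in advance because multiplying coefficients by
  weights need not preserve summability.\<close>

lemma eval_has_lie_derivative:
  assumes z: "norm z < 1" and q: "\<And>\<alpha>. weight l \<alpha> * coeff f \<alpha> = coeff q \<alpha>"
  shows "has_lie_derivative (\<lambda>z. eval z f) l z (eval z q)"
proof -
  have "coeff f \<alpha> * zpow_deriv \<alpha> z (diag_field l z) = coeff q \<alpha> * zpow z \<alpha>" for \<alpha>
    unfolding zpow_deriv_diag_field q[symmetric] by (simp only: ac_simps)
  hence "(\<Sum>\<^sub>\<infinity>\<alpha>. coeff f \<alpha> * zpow_deriv \<alpha> z (diag_field l z)) = eval z q"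
    by (simp only: eval_def)
  with eval_has_derivative[OF z, of f] show ?thesis
    unfolding has_lie_derivative_def by blast
qed

section \<open>Inverting the derivation along a diagonal field\<close>

text \<open>Resonant monomials, and those with a small divisor, are mapped to 0.\<close>

lift_definition weight_inv :: "complex^'n \<Rightarrow> 'n::finite lps \<Rightarrow> 'n lps" is
  "\<lambda>l f \<alpha>. if 1 \<le> norm (weight l \<alpha>) then f \<alpha> / weight l \<alpha> else 0"
  by (rule Infinite_Sum.abs_summable_on_comparison_test, assumption)
     (auto simp: norm_divide divide_simps mult_le_cancel_left1)

text \<open>Division takes place only by weights of modulus at least 1, so inverting the derivation
  costs nothing in the contraction estimate.\<close>

lemma norm_weight_inv_le: "norm (weight_inv l f) \<le> norm f"
  unfolding norm_lps_def
proof (rule infsum_mono[OF coeff_summable coeff_summable])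
  fix \<alpha>
  show "norm (coeff (weight_inv l f) \<alpha>) \<le> norm (coeff f \<alpha>)"
    using mult_left_mono[of 1 "norm (weight l \<alpha>)" "norm (coeff f \<alpha>)"]
    by (auto simp: weight_inv.rep_eq norm_divide divide_simps)
qed

lemma weight_inv_diff: "weight_inv l (f - g) = weight_inv l f - weight_inv l g"
  by (rule lps_eqI) (simp add: weight_inv.rep_eq diff_divide_distrib)

lemma weight_0 [simp]: "weight l 0 = 0"
  by (simp add: weight_def)

lemma weight_mult_coeff_weight_inv:
  assumes "coeff q \<alpha> \<noteq> 0 \<Longrightarrow> 1 \<le> norm (weight l \<alpha>)"
  shows "weight l \<alpha> * coeff (weight_inv l q) \<alpha> = coeff q \<alpha>"
  using assms by (cases "weight l \<alpha> = 0") (auto simp: weight_inv.rep_eq)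

section \<open>Series in a subset of the variables\<close>

definition supported :: "'n set \<Rightarrow> 'n::finite lps set" where
  "supported V = {f. \<forall>\<alpha>. (\<exists>j. j \<notin> V \<and> \<alpha> j \<noteq> 0) \<longrightarrow> coeff f \<alpha> = 0}"

text \<open>Closedness keeps the domain of the contraction complete, so that the fixed point
  inherits the prescribed supports.\<close>

lemma closed_supported: "closed (supported V)"
  unfolding supported_def
  by (intro closed_Collect_all closed_Collect_imp closed_Collect_eq continuous_on_const
      linear_continuous_on bounded_linear_coeff) auto

lemma supported_one: "1 \<in> supported V"
  by (auto simp: supported_def one_lps.rep_eq)

lemma supported_add: "f \<in> supported V \<Longrightarrow> g \<in> supported V \<Longrightarrow> f + g \<in> supported V"
  by (simp add: supported_def)

lemma supported_0: "0 \<in> supported V"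
  by (simp add: supported_def)

lemma supported_sum: "(\<And>i. i \<in> I \<Longrightarrow> f i \<in> supported V) \<Longrightarrow> sum f I \<in> supported V"
  by (induction I rule: infinite_finite_induct) (auto intro: supported_add supported_0)

lemma supported_mult:
  assumes "f \<in> supported V" "g \<in> supported V"
  shows "f * g \<in> supported V"
  unfolding supported_def
proof (intro CollectI allI impI)
  fix \<gamma> :: "'a \<Rightarrow> nat" assume "\<exists>j. j \<notin> V \<and> \<gamma> j \<noteq> 0"
  then obtain j where j: "j \<notin> V" "\<gamma> j \<noteq> 0" by blast
  have "coeff f (fst p) * coeff g (snd p) = 0" if "p \<in> splits \<gamma>" for p
  proof -
    have "fst p j + snd p j \<noteq> 0" using that j(2) by auto
    hence "fst p j \<noteq> 0 \<or> snd p j \<noteq> 0" by simp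
    thus ?thesis using assms j(1) unfolding supported_def by auto
  qed
  thus "coeff (f * g) \<gamma> = 0"
    by (simp add: times_lps.rep_eq sum.neutral del: mem_splits)
qed

lemma supported_mono: "V \<subseteq> W \<Longrightarrow> supported V \<subseteq> supported W"
  by (auto simp: supported_def)

lemma supported_weight_inv: "f \<in> supported V \<Longrightarrow> weight_inv l f \<in> supported V"
  by (simp add: supported_def weight_inv.rep_eq)

definition unit_index :: "'n \<Rightarrow> 'n \<Rightarrow> nat" where
  "unit_index j = (\<lambda>i. if i = j then 1 else 0)"

lemma supported_monomial: "(c \<noteq> 0 \<Longrightarrow> j \<in> V) \<Longrightarrow> monomial (unit_index j) c \<in> supported V"
  by (auto simp: supported_def monomial.rep_eq unit_index_def)

lemma unit_index_neq_0 [simp]: "unit_index j \<noteq> 0"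
  by (auto simp: unit_index_def fun_eq_iff)

lemma unit_index_le_iff: "unit_index j \<le> \<alpha> \<longleftrightarrow> \<alpha> j \<noteq> 0"
  by (auto simp: unit_index_def le_fun_def)

lemma zpow_unit_index: "zpow z (unit_index j) = z $ j"
  unfolding zpow_def by (subst prod.remove[of UNIV j]) (auto simp: unit_index_def)

lemma weight_unit_index: "weight l (unit_index j) = l $ j"
  unfolding weight_def by (subst sum.remove[of UNIV j]) (auto simp: unit_index_def)

section \<open>Solving the linearization equation by contraction\<close>

text \<open>This is the right-hand side
  \<open>X\<^sub>i (\<Sum>j. A\<^sub>i\<^sub>j y\<^sub>j X\<^sub>j)\<close> after the substitution
  \<open>y = r z\<close>, which puts the small factor \<open>r\<close> in front of the
  interactions.\<close>

definition quad_term ::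
  "real \<Rightarrow> complex^'n^'n \<Rightarrow> ('n::finite lps)^'n \<Rightarrow> 'n \<Rightarrow> 'n lps" where
  "quad_term r A X i = (\<Sum>j\<in>UNIV. monomial (unit_index j) (of_real r * A $ i $ j) * (X $ j * X $ i))"

text \<open>Where \<open>A $ i $ j\<close> is nonzero, equation \<open>i\<close> contains both the
  variable \<open>j\<close> and the series \<open>X $ j\<close>; hence the closure condition on
  \<open>V\<close>.\<close>

lemma supported_quad_term:
  assumes X: "\<And>j. X $ j \<in> supported (V j)"
    and V: "\<And>j. A $ i $ j \<noteq> 0 \<Longrightarrow> j \<in> V i \<and> V j \<subseteq> V i"
  shows "quad_term r A X i \<in> supported (V i)"
  unfolding quad_term_def
proof (rule supported_sum)
  fix j
  show "monomial (unit_index j) (of_real r * A $ i $ j) * (X $ j * X $ i) \<in> supported (V i)"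
  proof (cases "A $ i $ j = 0")
    case True
    hence "monomial (unit_index j) (of_real r * A $ i $ j) = 0"
      by (intro lps_eqI) (simp add: monomial.rep_eq)
    thus ?thesis by (simp add: supported_0)
  next
    case False
    show ?thesis
      using V[OF False] X supported_mono[of "V j" "V i"]
      by (intro supported_mult supported_monomial) auto
  qed
qed

lemma coeff_sum: "coeff (\<Sum>i\<in>I. f i) \<alpha> = (\<Sum>i\<in>I. coeff (f i) \<alpha>)"
  by (induction I rule: infinite_finite_induct) auto

lemma coeff_quad_term_0: "coeff (quad_term r A X i) 0 = 0"
  by (simp add: quad_term_def coeff_sum coeff_monomial_mult unit_index_le_iff)

lemma eval_quad_term:
  "norm z \<le> 1 \<Longrightarrow> eval z (quad_term r A X i)
    = eval z (X $ i) * (\<Sum>j\<in>UNIV. of_real r * A $ i $ j * z $ j * eval z (X $ j))"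
  by (simp add: quad_term_def eval_sum eval_mult eval_monomial zpow_unit_index sum_distrib_left mult_ac)

text \<open>The contraction acts on series of norm at most 2 with the given supports. Products are
  then bounded by 4 and have Lipschitz constant 4, so the bound 1/8 makes the quadratic part at most
  1/2 and the contraction constant 1/2. Resonant terms may still be discarded by
  \<open>weight_inv\<close> at this stage.\<close>

lemma exists_fixed_point:
  fixes A :: "complex^'n^'n::finite"
  assumes r: "0 \<le> r" "r * (\<Sum>i\<in>UNIV. \<Sum>j\<in>UNIV. norm (A $ i $ j)) \<le> 1 / 8"
    and V: "\<And>i j. A $ i $ j \<noteq> 0 \<Longrightarrow> j \<in> V i \<and> V j \<subseteq> V i"
  obtains X where "\<And>i. X $ i = 1 + weight_inv l (quad_term r A X i)"
    and "\<And>i. norm (X $ i) \<le> 2" and "\<And>i. X $ i \<in> supported (V i)"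
proof -
  define C where "C = {X :: ('n lps)^'n. \<forall>i. X $ i \<in> cball 0 2 \<inter> supported (V i)}"
  define T where "T X = (\<chi> i. 1 + weight_inv l (quad_term r A X i))" for X :: "('n lps)^'n"
  define R where "R i = (\<Sum>j\<in>UNIV. norm (of_real r * A $ i $ j))" for i
  have R_nonneg: "0 \<le> R i" for i by (simp add: R_def sum_nonneg)
  have sum_R: "sum R UNIV \<le> 1 / 8"
    using r by (simp add: R_def norm_mult sum_distrib_left)
  have R_le: "R i \<le> 1 / 8" for i
    using member_le_sum[of i UNIV R] R_nonneg sum_R by auto
  have "closed C"
    unfolding C_def
    by (intro closed_Collect_all closed_vimage[unfolded vimage_def] closed_Int closed_cball closed_supported
        continuous_intros)
  have bound: "norm (X $ i) \<le> 2" if "X \<in> C" for X i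
    using that by (simp add: C_def)
  have supp: "quad_term r A X i \<in> supported (V i)" if X: "X \<in> C" for X i
    using X by (intro supported_quad_term V) (auto simp: C_def)
  have "T X \<in> C" if X: "X \<in> C" for X
  proof -
    have "norm (1 + weight_inv l (quad_term r A X i)) \<le> 2" for i
    proof -
      have "norm (quad_term r A X i) \<le> (\<Sum>j\<in>UNIV. norm (of_real r * A $ i $ j) * (2 * 2))"
        unfolding quad_term_def
      proof (rule sum_norm_le)
        fix j
        have "norm (X $ j * X $ i) \<le> 2 * 2"
          using norm_mult_ineq[of "X $ j" "X $ i"] mult_mono[OF bound[OF X, of j] bound[OF X, of i]] by simp
        thus "norm (monomial (unit_index j) (of_real r * A $ i $ j) * (X $ j * X $ i))
            \<le> norm (of_real r * A $ i $ j) * (2 * 2)"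
          by (intro order_trans[OF norm_mult_ineq]) (simp only: norm_monomial mult_left_mono norm_ge_zero)
      qed
      also have "\<dots> = R i * 4" by (simp add: R_def sum_distrib_right)
      also have "\<dots> \<le> 1" using R_le[of i] by simp
      finally show ?thesis
        using norm_triangle_ineq[of 1 "weight_inv l (quad_term r A X i)"] norm_weight_inv_le[of l "quad_term r A X i"]
        by simp
    qed
    thus ?thesis
      using supp[OF X] by (simp add: C_def T_def supported_add supported_one supported_weight_inv)
  qed
  moreover have "dist (T X) (T Y) \<le> 1 / 2 * dist X Y" if X: "X \<in> C" and Y: "Y \<in> C" for X Y
  proof -
    have "norm (T X - T Y) \<le> (\<Sum>i\<in>UNIV. norm ((T X - T Y) $ i))"
      by (rule norm_le_sum_norm_nth)
    also have "\<dots> \<le> (\<Sum>i\<in>UNIV. R i * (4 * norm (X - Y)))"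
    proof (rule sum_mono)
      fix i
      have "norm ((T X - T Y) $ i) = norm (weight_inv l (quad_term r A X i - quad_term r A Y i))"
        by (simp add: T_def weight_inv_diff)
      also have "\<dots> \<le> norm (quad_term r A X i - quad_term r A Y i)"
        by (rule norm_weight_inv_le)
      also have "\<dots> = norm (\<Sum>j\<in>UNIV. monomial (unit_index j) (of_real r * A $ i $ j) * (X $ j * X $ i - Y $ j * Y $ i))"
        by (simp add: quad_term_def sum_subtractf right_diff_distrib)
      also have "\<dots> \<le> (\<Sum>j\<in>UNIV. norm (of_real r * A $ i $ j) * (4 * norm (X - Y)))"
      proof (rule sum_norm_le)
        fix j
        have d: "norm (X $ k - Y $ k) \<le> norm (X - Y)" for k
          using Finite_Cartesian_Product.norm_nth_le[of "X - Y" k] by simp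
        \<comment> \<open>Changing one factor at a time makes the difference of products linear in
          \<open>X - Y\<close>.\<close>
        have "X $ j * X $ i - Y $ j * Y $ i = (X $ j - Y $ j) * X $ i + Y $ j * (X $ i - Y $ i)"
          by (simp add: algebra_simps)
        also have "norm \<dots> \<le> norm (X $ j - Y $ j) * norm (X $ i) + norm (Y $ j) * norm (X $ i - Y $ i)"
          by (intro order_trans[OF norm_triangle_ineq] add_mono norm_mult_ineq)
        also have "\<dots> \<le> norm (X - Y) * 2 + 2 * norm (X - Y)"
          by (intro add_mono mult_mono d bound X Y) auto
        finally have "norm (X $ j * X $ i - Y $ j * Y $ i) \<le> 4 * norm (X - Y)" by simp
        thus "norm (monomial (unit_index j) (of_real r * A $ i $ j) * (X $ j * X $ i - Y $ j * Y $ i))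
            \<le> norm (of_real r * A $ i $ j) * (4 * norm (X - Y))"
          by (intro order_trans[OF norm_mult_ineq]) (simp only: norm_monomial mult_left_mono norm_ge_zero)
      qed
      also have "\<dots> = R i * (4 * norm (X - Y))" by (simp add: R_def sum_distrib_right)
      finally show "norm ((T X - T Y) $ i) \<le> R i * (4 * norm (X - Y))" .
    qed
    also have "\<dots> = sum R UNIV * (4 * norm (X - Y))" by (simp add: sum_distrib_right)
    also have "\<dots> \<le> 1 / 8 * (4 * norm (X - Y))" by (intro mult_right_mono sum_R) simp
    finally show ?thesis by (simp add: dist_norm)
  qed
  moreover have "(\<chi> i. 1) \<in> C" by (simp add: C_def supported_one)
  ultimately have "\<exists>!X\<in>C. T X = X"
    using \<open>closed C\<close> by (intro Banach_fix[where c = "1 / 2"]) (auto simp: complete_eq_closed)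
  then obtain X where X: "X \<in> C" "T X = X" by blast
  show ?thesis
  proof (rule that)
    show "X $ i = 1 + weight_inv l (quad_term r A X i)" for i
      using arg_cong[OF X(2), of "\<lambda>Y. Y $ i"] by (simp add: T_def)
  qed (use X(1) in \<open>auto simp: C_def\<close>)
qed

text \<open>The derivation kills the constant 1 and undoes \<open>weight_inv\<close> on nonresonant
  coefficients, so the fixed point equation becomes the differential equation.\<close>

lemma fixed_point_lie_derivative:
  assumes z: "norm z < 1" and X: "X = 1 + weight_inv l q"
    and nonres: "\<And>\<alpha>. coeff q \<alpha> \<noteq> 0 \<Longrightarrow> 1 \<le> norm (weight l \<alpha>)"
  shows "has_lie_derivative (\<lambda>z. eval z X) l z (eval z q)"
proof (rule eval_has_lie_derivative[OF z])
  fix \<alpha>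
  have "weight l \<alpha> * coeff X \<alpha> = weight l \<alpha> * coeff (weight_inv l q) \<alpha>"
    by (cases "\<alpha> = 0") (simp_all add: X one_lps.rep_eq weight_inv.rep_eq)
  thus "weight l \<alpha> * coeff X \<alpha> = coeff q \<alpha>"
    by (simp add: weight_mult_coeff_weight_inv nonres)
qed

text \<open>Nothing is discarded here: the quadratic term has no constant coefficient, and its
  remaining exponents lie in \<open>V i\<close>, where the weights are bounded below.\<close>

lemma exists_nonresonant_solution:
  fixes A :: "complex^'n^'n::finite"
  assumes r: "0 \<le> r" "r * (\<Sum>i\<in>UNIV. \<Sum>j\<in>UNIV. norm (A $ i $ j)) \<le> 1 / 8"
    and V: "\<And>i j. A $ i $ j \<noteq> 0 \<Longrightarrow> j \<in> V i \<and> V j \<subseteq> V i"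
    and nonres: "\<And>i \<alpha>. \<alpha> \<noteq> 0 \<Longrightarrow> (\<And>j. j \<notin> V i \<Longrightarrow> \<alpha> j = 0) \<Longrightarrow> 1 \<le> norm (weight l \<alpha>)"
  obtains X where "\<And>i. X $ i = 1 + weight_inv l (quad_term r A X i)"
    and "\<And>i. norm (X $ i) \<le> 2" and "\<And>i. X $ i \<in> supported (V i)" and "\<And>i. coeff (X $ i) 0 = 1"
    and "\<And>i z. norm z < 1 \<Longrightarrow> has_lie_derivative (\<lambda>z. eval z (X $ i)) l z
      (eval z (X $ i) * (\<Sum>j\<in>UNIV. of_real r * A $ i $ j * z $ j * eval z (X $ j)))"
proof -
  obtain X where X: "\<And>i. X $ i = 1 + weight_inv l (quad_term r A X i)"
    and X2: "\<And>i. norm (X $ i) \<le> 2" and XV: "\<And>i. X $ i \<in> supported (V i)"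
    using exists_fixed_point[where A = A and V = V and l = l, OF r V] by blast
  show ?thesis
  proof (rule that[OF X X2 XV])
    show "coeff (X $ i) 0 = 1" for i
      by (subst X) (simp add: one_lps.rep_eq weight_inv.rep_eq)
    fix i z assume z: "norm (z :: complex^'n) < 1"
    have "has_lie_derivative (\<lambda>z. eval z (X $ i)) l z (eval z (quad_term r A X i))"
    proof (rule fixed_point_lie_derivative[OF z X])
      fix \<alpha> assume \<alpha>: "coeff (quad_term r A X i) \<alpha> \<noteq> 0"
      show "1 \<le> norm (weight l \<alpha>)"
      proof (rule nonres)
        show "\<alpha> \<noteq> 0" using \<alpha> coeff_quad_term_0[of r A X i] by metis
        show "\<alpha> j = 0" if "j \<notin> V i" for j
          using supported_quad_term[where X = X and V = V and A = A and i = i and r = r, OF XV V] that \<alpha>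
          unfolding supported_def by blast
      qed
    qed
    thus "has_lie_derivative (\<lambda>z. eval z (X $ i)) l z
      (eval z (X $ i) * (\<Sum>j\<in>UNIV. of_real r * A $ i $ j * z $ j * eval z (X $ j)))"
      using z by (simp add: eval_quad_term)
  qed
qed

section \<open>Linearization of Lotka-Volterra systems\<close>

definition lv_field :: "complex^'n \<Rightarrow> complex^'n^'n \<Rightarrow> complex^'n \<Rightarrow> complex^'n" where
  "lv_field l A x = (\<chi> i. x $ i * (l $ i + (\<Sum>j\<in>UNIV. A $ i $ j * x $ j)))"

text \<open>Undoes the rescaling: a solution on the unit ball yields the coordinate change
  \<open>x\<^sub>i = y\<^sub>i X\<^sub>i(y/r)\<close> on the ball of radius
  \<open>r\<close>.\<close>

lemma lv_linearization:
  fixes X :: "(3 lps)^3"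
  assumes r: "0 < r" and X0: "\<And>i. coeff (X $ i) 0 = 1"
    and lie: "\<And>i z. norm z < 1 \<Longrightarrow> has_lie_derivative (\<lambda>z. eval z (X $ i)) l z
      (eval z (X $ i) * (\<Sum>j\<in>UNIV. of_real r * A $ i $ j * z $ j * eval z (X $ j)))"
  shows "\<exists>h. convergent_ps_order_ge_2 h \<and> transforms_near_0 (\<lambda>y. y + h y) (lv_field l A) (diag_field l)"
proof -
  define s where "s y = (1 / r) *\<^sub>R y" for y :: "complex^3"
  define h where "h y = (\<chi> i. y $ i * (eval (s y) (X $ i) - 1))" for y
  define Y where "Y i = monomial (unit_index i) 1 * (X $ i - 1)" for i
  \<comment> \<open>One factor \<open>r\<close> comes from \<open>y\<^sub>i = r z\<^sub>i\<close>;
    the powers of \<open>1 / r\<close> come from rewriting monomials in \<open>z\<close> as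
    monomials in \<open>y\<close>.\<close>
  define c where "c \<alpha> = (\<chi> i. of_real (r * (1 / r) ^ (\<Sum>j\<in>UNIV. \<alpha> j)) * coeff (Y i) \<alpha>)" for \<alpha>
  have s: "norm (s y) < 1" if "y \<in> ball 0 r" for y
    using that r by (simp add: s_def divide_simps)
  have ev: "\<forall>\<^sub>F y in nhds 0. y \<in> ball 0 r"
    using r by (intro eventually_nhds_in_open) auto
  have "c \<alpha> = 0" if deg: "(\<Sum>j\<in>UNIV. \<alpha> j) < 2" for \<alpha>
  proof -
    have "coeff (Y i) \<alpha> = 0" for i
    proof (cases "\<alpha> i = 0")
      case False
      \<comment> \<open>A nonzero entry at \<open>i\<close> with total degree below 2 leaves only
        \<open>unit_index i\<close>, where the coefficient is
        \<open>X\<^sub>i(0) - 1 = 0\<close>.\<close>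
      have "\<alpha> j = unit_index i j" for j
        using False deg member_le_sum[of i UNIV \<alpha>] sum_mono2[of UNIV "{i, j}" \<alpha>]
        by (cases "j = i") (auto simp: unit_index_def)
      hence "\<alpha> = unit_index i" ..
      hence "\<alpha> - unit_index i = 0" by (auto simp: fun_eq_iff)
      thus ?thesis by (simp add: Y_def coeff_monomial_mult X0 one_lps.rep_eq)
    qed (simp add: Y_def coeff_monomial_mult unit_index_le_iff)
    thus ?thesis by (simp add: c_def vec_eq_iff)
  qed
  moreover have "((\<lambda>\<alpha>. c \<alpha> $ i * (\<Prod>j\<in>UNIV. (y $ j) ^ \<alpha> j)) has_sum h y $ i) UNIV"
    if y: "y \<in> ball 0 r" for y i
  proof -
    have "of_real r * eval (s y) (Y i) = h y $ i"
      using s[OF y] r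
      by (simp add: Y_def h_def eval_mult eval_diff eval_1 eval_monomial zpow_unit_index)
         (simp add: s_def scaleR_conv_of_real[where 'a = complex])
    moreover have "of_real r * (coeff (Y i) \<alpha> * zpow (s y) \<alpha>) = c \<alpha> $ i * zpow y \<alpha>" for \<alpha>
      by (simp add: c_def s_def zpow_scaleR)
    ultimately show ?thesis
      using has_sum_cmult_right[OF eval_has_sum[of "s y" "Y i"], of "of_real r"] s[OF y]
      by (simp add: zpow_def less_imp_le)
  qed
  ultimately have "convergent_ps_order_ge_2 h"
    unfolding convergent_ps_order_ge_2_def
    by (intro exI[of _ c] conjI allI impI eventually_mono[OF ev]) auto
  moreover have "\<exists>D. ((\<lambda>y. y + h y) has_derivative D) (at y) \<and> D (diag_field l y) = lv_field l A (y + h y)"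
    if y: "y \<in> ball 0 r" for y
  proof -
    define E where "E i = eval (s y) (X $ i)" for i
    obtain D where D: "\<And>i. ((\<lambda>z. eval z (X $ i)) has_derivative D i) (at (s y))"
      and D_diag: "\<And>i. D i (diag_field l (s y)) = E i * (\<Sum>j\<in>UNIV. of_real r * A $ i $ j * s y $ j * E j)"
      using lie[OF s[OF y]] unfolding has_lie_derivative_def E_def by metis
    have s_deriv: "(s has_derivative s) (at y)"
      unfolding s_def[abs_def] by (intro bounded_linear_imp_has_derivative bounded_linear_scaleR_right)
    have "((\<lambda>y. y $ i * eval (s y) (X $ i)) has_derivative (\<lambda>k. y $ i * D i (s k) + k $ i * E i)) (at y)" for i
      unfolding E_def
      by (intro has_derivative_mult has_derivative_compose[OF s_deriv D] bounded_linear_imp_has_derivative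
          bounded_linear_vec_nth)
    hence "((\<lambda>y. y + h y) has_derivative (\<lambda>k. \<chi> i. y $ i * D i (s k) + k $ i * E i)) (at y)"
      by (intro has_derivative_vec) (simp add: h_def right_diff_distrib)
    moreover have "(\<chi> i. y $ i * D i (s (diag_field l y)) + diag_field l y $ i * E i) = lv_field l A (y + h y)"
    proof -
      have "s (diag_field l y) = diag_field l (s y)"
        by (simp add: s_def diag_field_def vec_eq_iff)
      moreover have "of_real r * A $ i $ j * s y $ j * E j = A $ i $ j * (y $ j * E j)" for i j
        using r by (simp add: s_def scaleR_conv_of_real[where 'a = complex])
      ultimately have "y $ i * D i (s (diag_field l y)) + diag_field l y $ i * E i
          = y $ i * E i * (l $ i + (\<Sum>j\<in>UNIV. A $ i $ j * (y $ j * E j)))" for i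
        by (simp only: D_diag) (simp add: diag_field_def algebra_simps)
      moreover have "(y + h y) $ i = y $ i * E i" for i
        by (simp add: h_def E_def right_diff_distrib)
      ultimately show ?thesis by (simp add: lv_field_def vec_eq_iff)
    qed
    ultimately show ?thesis by blast
  qed
  hence "transforms_near_0 (\<lambda>y. y + h y) (lv_field l A) (diag_field l)"
    unfolding transforms_near_0_def by (intro eventually_mono[OF ev])
  ultimately show ?thesis by blast
qed

lemma exists_small_radius:
  fixes a :: real
  assumes "0 \<le> a"
  obtains r where "0 < r" "r * a \<le> 1 / 8"
proof
  \<comment> \<open>Using \<open>a + 1\<close> also covers \<open>a = 0\<close>.\<close>
  show "0 < 1 / (8 * (a + 1))" "1 / (8 * (a + 1)) * a \<le> 1 / 8"
    using assms by (auto simp: divide_simps)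
qed

lemma lv_linearization_of_nonresonant_supports:
  fixes A :: "complex^3^3"
  assumes "\<And>i j. A $ i $ j \<noteq> 0 \<Longrightarrow> j \<in> V i \<and> V j \<subseteq> V i"
    and "\<And>i \<alpha>. \<alpha> \<noteq> 0 \<Longrightarrow> (\<And>j. j \<notin> V i \<Longrightarrow> \<alpha> j = 0) \<Longrightarrow> 1 \<le> norm (weight l \<alpha>)"
  shows "\<exists>h. convergent_ps_order_ge_2 h \<and> transforms_near_0 (\<lambda>y. y + h y) (lv_field l A) (diag_field l)"
proof -
  obtain r where r: "0 < r" "r * (\<Sum>i\<in>UNIV. \<Sum>j\<in>UNIV. norm (A $ i $ j)) \<le> 1 / 8"
    by (rule exists_small_radius[of "\<Sum>i\<in>UNIV. \<Sum>j\<in>UNIV. norm (A $ i $ j)"]) (auto intro!: sum_nonneg)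
  show ?thesis
    by (rule exists_nonresonant_solution[OF less_imp_le[OF r(1)] r(2) assms], assumption+)
       (rule lv_linearization[OF r(1)], assumption+)
qed

section \<open>The spectrum of cube roots of unity\<close>

definition zeta_spectrum :: "complex \<Rightarrow> complex^3" where
  "zeta_spectrum \<zeta> = vector [1, \<zeta>, \<zeta>^2]"

lemma zeta_spectrum_nth [simp]:
  "zeta_spectrum \<zeta> $ 1 = 1" "zeta_spectrum \<zeta> $ 2 = \<zeta>" "zeta_spectrum \<zeta> $ 3 = \<zeta>^2"
  by (simp_all add: zeta_spectrum_def)

context
  fixes \<zeta> :: complex
  assumes \<zeta>3: "\<zeta>^3 = 1" and \<zeta>1: "\<zeta> \<noteq> 1"
begin

lemma zeta_square: "\<zeta>^2 = - 1 - \<zeta>"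
proof -
  have "(\<zeta> - 1) * (\<zeta>^2 + \<zeta> + 1) = \<zeta>^3 - 1" by (simp add: algebra_simps power2_eq_square power3_eq_cube)
  hence "\<zeta>^2 + \<zeta> + 1 = 0" using \<zeta>3 \<zeta>1 by simp
  moreover have "\<zeta>^2 - (- 1 - \<zeta>) = \<zeta>^2 + \<zeta> + 1" by simp
  ultimately have "\<zeta>^2 - (- 1 - \<zeta>) = 0" by (rule trans[rotated])
  thus ?thesis by (rule eq_iff_diff_eq_0[THEN iffD2])
qed

text \<open>Only the square of \<open>Im \<zeta>\<close> is determined, since \<open>\<zeta>\<close>
  may be either primitive cube root of unity.\<close>

lemma zeta_Re: "Re \<zeta> = - 1 / 2" and zeta_Im: "(Im \<zeta>)^2 = 3 / 4"
proof -
  have re: "(Re \<zeta>)^2 - (Im \<zeta>)^2 = - 1 - Re \<zeta>"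
    using arg_cong[OF zeta_square, of Re] by (simp add: power2_eq_square)
  have "2 * Re \<zeta> * Im \<zeta> = - Im \<zeta>"
    using arg_cong[OF zeta_square, of Im] by (simp add: power2_eq_square mult.commute mult.left_commute)
  hence "Im \<zeta> * (2 * Re \<zeta> + 1) = 0" by (simp add: algebra_simps)
  moreover have "Im \<zeta> \<noteq> 0"
  proof
    assume "Im \<zeta> = 0"
    hence "(2 * Re \<zeta> + 1)^2 + 3 = 0" using re by (simp add: power2_eq_square algebra_simps)
    thus False using zero_le_power2[of "2 * Re \<zeta> + 1"] by linarith
  qed
  ultimately show "Re \<zeta> = - 1 / 2" by simp
  with re show "(Im \<zeta>)^2 = 3 / 4" by (simp add: power2_eq_square)
qed

text \<open>The squared modulus is the norm form \<open>m^2 - m * n + n^2\<close>, an integer;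
  completing the square shows that it is positive.\<close>

lemma norm_eisenstein_ge_1:
  fixes m n :: int
  assumes "m \<noteq> 0 \<or> n \<noteq> 0"
  shows "1 \<le> norm (of_int m + of_int n * \<zeta>)"
proof -
  have "(norm (of_int m + of_int n * \<zeta>))^2 = (of_int m + of_int n * Re \<zeta>)^2 + (of_int n)^2 * (Im \<zeta>)^2"
    by (simp add: cmod_power2 power_mult_distrib)
  also have "\<dots> = real_of_int (m^2 - m * n + n^2)"
    unfolding zeta_Re zeta_Im by (simp add: power2_eq_square algebra_simps)
  finally have eq: "(norm (of_int m + of_int n * \<zeta>))^2 = real_of_int (m^2 - m * n + n^2)" .
  define k where "k = m^2 - m * n + n^2"
  have "4 * k = (2 * m - n)^2 + 3 * n^2"
    by (simp add: k_def power2_eq_square algebra_simps)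
  also have "\<dots> > 0"
    using assms by (cases "n = 0") (auto simp: add_nonneg_pos)
  finally have "1 \<le> k" by linarith
  hence "1 \<le> (norm (of_int m + of_int n * \<zeta>))^2" unfolding eq k_def[symmetric] by simp
  thus ?thesis using power2_le_imp_le[of 1 "norm (of_int m + of_int n * \<zeta>)"] by simp
qed

text \<open>Eliminating \<open>\<zeta>^2\<close> writes the weight as an Eisenstein integer with
  coordinates \<open>\<alpha> 1 - \<alpha> 3\<close> and
  \<open>\<alpha> 2 - \<alpha> 3\<close>.\<close>

lemma norm_weight_ge_1:
  assumes "\<not> (\<alpha> 1 = \<alpha> 2 \<and> \<alpha> 2 = \<alpha> 3)"
  shows "1 \<le> norm (weight (zeta_spectrum \<zeta>) \<alpha>)"
proof -
  have "weight (zeta_spectrum \<zeta>) \<alpha> = of_int (int (\<alpha> 1) - int (\<alpha> 3)) + of_int (int (\<alpha> 2) - int (\<alpha> 3)) * \<zeta>"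
    by (simp add: weight_def sum_3 zeta_square algebra_simps)
  moreover have ne: "int (\<alpha> 1) - int (\<alpha> 3) \<noteq> 0 \<or> int (\<alpha> 2) - int (\<alpha> 3) \<noteq> 0"
    using assms by auto
  ultimately show ?thesis using norm_eisenstein_ge_1[OF ne] by (simp only:)
qed

text \<open>If one variable is absent, three equal exponents must all be 0.\<close>

lemma norm_weight_ge_1_of_support:
  fixes V :: "3 set"
  assumes "V \<noteq> UNIV" "\<alpha> \<noteq> 0" "\<And>j. j \<notin> V \<Longrightarrow> \<alpha> j = 0"
  shows "1 \<le> norm (weight (zeta_spectrum \<zeta>) \<alpha>)"
proof (rule norm_weight_ge_1, rule notI)
  assume eq: "\<alpha> 1 = \<alpha> 2 \<and> \<alpha> 2 = \<alpha> 3"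
  obtain k where "\<alpha> k = 0" using assms(1,3) by blast
  hence "\<alpha> j = 0" for j using eq exhaust_3[of k] exhaust_3[of j] by auto
  thus False using assms(2) by (simp add: fun_eq_iff)
qed

end

section \<open>The given system in Lotka-Volterra form\<close>

definition interaction :: "complex \<Rightarrow> params \<Rightarrow> complex^3^3" where
  "interaction \<zeta> p = vector [vector [a100 p, a010 p, a001 p], vector [\<zeta> * b100 p, \<zeta>, 0],
     vector [0, \<zeta>^2 * c010 p, \<zeta>^2 * c001 p]]"

lemma interaction_nth [simp]:
  "interaction \<zeta> p $ 1 $ 1 = a100 p" "interaction \<zeta> p $ 1 $ 2 = a010 p" "interaction \<zeta> p $ 1 $ 3 = a001 p"
  "interaction \<zeta> p $ 2 $ 1 = \<zeta> * b100 p" "interaction \<zeta> p $ 2 $ 2 = \<zeta>" "interaction \<zeta> p $ 2 $ 3 = 0"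
  "interaction \<zeta> p $ 3 $ 1 = 0" "interaction \<zeta> p $ 3 $ 2 = \<zeta>^2 * c010 p" "interaction \<zeta> p $ 3 $ 3 = \<zeta>^2 * c001 p"
  by (simp_all add: interaction_def)

lemma sys_field_eq_lv_field: "sys_field \<zeta> p = lv_field (zeta_spectrum \<zeta>) (interaction \<zeta> p)"
  by (simp add: sys_field_def lv_field_def fun_eq_iff vec_eq_iff forall_3 sum_3 zeta_spectrum_nth
      power2_eq_square algebra_simps)

lemma lin_field_eq_diag_field: "lin_field \<zeta> = diag_field (zeta_spectrum \<zeta>)"
  by (simp add: lin_field_def diag_field_def fun_eq_iff vec_eq_iff forall_3)

section \<open>Low-order coefficients and the obstruction for \<open>J9\<close>\<close>

lemma splits_unit_index: "splits (unit_index k) = {(0, unit_index k), (unit_index k, 0)}"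
proof (intro equalityI subsetI)
  fix p assume "p \<in> splits (unit_index k)"
  hence p: "fst p i + snd p i = (if i = k then 1 else 0)" for i
    by (auto simp: unit_index_def fun_eq_iff)
  have off: "fst p i = 0 \<and> snd p i = 0" if "i \<noteq> k" for i
    using p[of i] that by simp
  consider "fst p k = 0" "snd p k = 1" | "fst p k = 1" "snd p k = 0"
    using p[of k] by fastforce
  thus "p \<in> {(0, unit_index k), (unit_index k, 0)}"
  proof cases
    case 1
    hence "fst p = 0" "snd p = unit_index k"
      using off by (auto simp: fun_eq_iff unit_index_def) (metis zero_neq_one)+
    thus ?thesis by (cases p) simp
  next
    case 2
    hence "snd p = 0" "fst p = unit_index k"
      using off by (auto simp: fun_eq_iff unit_index_def) (metis zero_neq_one)+
    thus ?thesis by (cases p) simp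
  qed
qed auto

text \<open>Leibniz rule at the origin: an exponent of degree one splits in only two ways.\<close>

lemma coeff_mult_unit_index:
  "coeff (f * g) (unit_index k) = coeff f 0 * coeff g (unit_index k) + coeff f (unit_index k) * coeff g 0"
proof -
  have "(0, unit_index k) \<noteq> (unit_index k, 0 :: 'a \<Rightarrow> nat)"
    by (metis Pair_inject unit_index_neq_0)
  thus ?thesis by (simp add: times_lps.rep_eq splits_unit_index)
qed

lemma coeff_fixed_point:
  assumes "X = 1 + weight_inv l q" "\<alpha> \<noteq> 0" "1 \<le> norm (weight l \<alpha>)"
  shows "weight l \<alpha> * coeff X \<alpha> = coeff q \<alpha>"
  using weight_mult_coeff_weight_inv[of q \<alpha> l] assms by (simp add: one_lps.rep_eq)

lemma coeff_quad_term:
  "coeff (quad_term r A X i) \<alpha>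
    = (\<Sum>j\<in>UNIV. if \<alpha> j = 0 then 0 else of_real r * A $ i $ j * coeff (X $ j * X $ i) (\<alpha> - unit_index j))"
  unfolding quad_term_def coeff_sum coeff_monomial_mult unit_index_le_iff by (rule sum.cong) auto

lemma coeff_quad_term_unit_index:
  assumes "\<And>j. coeff (X $ j) 0 = 1"
  shows "coeff (quad_term r A X i) (unit_index k) = of_real r * A $ i $ k"
proof -
  have "unit_index k - unit_index k = 0" by (simp add: fun_eq_iff)
  thus ?thesis
    unfolding coeff_quad_term
    by (subst sum.remove[of UNIV k]) (auto simp: unit_index_def[of k] coeff_mult_0 assms intro!: sum.neutral)
qed

text \<open>The exponent of \<open>y\<^sub>2 y\<^sub>3\<close> is itself nonresonant, but becomes
  resonant after multiplication by \<open>y\<^sub>1\<close>. Its coefficient is computed from the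
  degree-one coefficients and contains the factor
  \<open>1 + \<zeta> + \<zeta>^2 = 0\<close>.\<close>

lemma resonant_coeff_eq_0:
  fixes \<zeta> :: complex and X :: "(3 lps)^3"
  assumes \<zeta>: "\<zeta>^3 = 1" "\<zeta> \<noteq> 1"
    and X: "\<And>i. X $ i = 1 + weight_inv (zeta_spectrum \<zeta>) (quad_term r A X i)"
    and X0: "\<And>i. coeff (X $ i) 0 = 1"
    and A: "A $ 1 $ 1 = 0" "A $ 2 $ 3 = 0" "\<zeta> * A $ 1 $ 2 = A $ 3 $ 2"
  shows "coeff (X $ 1) (unit_index 2 + unit_index 3) = 0"
proof -
  let ?e = "unit_index 2 + unit_index 3 :: 3 \<Rightarrow> nat"
  have \<zeta>0: "\<zeta> \<noteq> 0" using \<zeta>(1) by auto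
  have first: "coeff (X $ i) (unit_index k) = of_real r * A $ i $ k / zeta_spectrum \<zeta> $ k" for i k
  proof -
    have "1 \<le> norm (weight (zeta_spectrum \<zeta>) (unit_index k))"
      by (rule norm_weight_ge_1[OF \<zeta>]) (use exhaust_3[of k] in \<open>auto simp: unit_index_def\<close>)
    from coeff_fixed_point[OF X unit_index_neq_0 this]
    have "zeta_spectrum \<zeta> $ k * coeff (X $ i) (unit_index k) = of_real r * A $ i $ k"
      by (simp add: weight_unit_index coeff_quad_term_unit_index X0)
    moreover have "zeta_spectrum \<zeta> $ k \<noteq> 0"
      using exhaust_3[of k] \<zeta>0 by auto
    ultimately show ?thesis by (simp add: field_simps)
  qed
  have e: "?e 1 = 0" "?e 2 = 1" "?e 3 = 1" by (simp_all add: unit_index_def)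
  have sub: "?e - unit_index 2 = unit_index 3" "?e - unit_index 3 = unit_index 2"
    by (simp_all add: fun_eq_iff)
  have ne: "?e \<noteq> 0" using e(2) by (metis zero_fun_apply zero_neq_one)
  have "1 \<le> norm (weight (zeta_spectrum \<zeta>) ?e)"
    by (rule norm_weight_ge_1[OF \<zeta>]) (use e in simp)
  from coeff_fixed_point[OF X ne this]
  have "weight (zeta_spectrum \<zeta>) ?e * coeff (X $ 1) ?e = coeff (quad_term r A X 1) ?e" .
  moreover have "weight (zeta_spectrum \<zeta>) ?e = - 1"
    using zeta_square[OF \<zeta>] by (simp only: weight_def sum_3 e) simp
  moreover have "coeff (quad_term r A X 1) ?e
      = of_real r * A $ 1 $ 2 * coeff (X $ 2 * X $ 1) (unit_index 3)
        + of_real r * A $ 1 $ 3 * coeff (X $ 3 * X $ 1) (unit_index 2)"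
    unfolding coeff_quad_term sum_3 e sub by simp
  \<comment> \<open>The Leibniz rule reduces everything to \<open>first\<close>; the contribution of
    \<open>X $ 2\<close> vanishes because \<open>A $ 2 $ 3 = 0\<close>.\<close>
  moreover have "\<dots> = of_real r * of_real r * A $ 1 $ 3 * (A $ 1 $ 2 / \<zeta>^2 + A $ 3 $ 2 / \<zeta> + A $ 1 $ 2 / \<zeta>)"
    by (simp add: coeff_mult_unit_index X0 first A(2) algebra_simps)
  moreover have "A $ 1 $ 2 / \<zeta>^2 + A $ 3 $ 2 / \<zeta> + A $ 1 $ 2 / \<zeta> = A $ 1 $ 2 * (1 + \<zeta> + \<zeta>^2) / \<zeta>^2"
    unfolding A(3)[symmetric] using \<zeta>0 by (simp add: field_simps power2_eq_square)
  ultimately show ?thesis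
    using zeta_square[OF \<zeta>] by simp
qed

section \<open>The Bernoulli correction\<close>

lemma has_derivative_on_unit_ball:
  assumes "norm z < 1" "(f has_derivative D) (at z)" "\<And>w. norm w < 1 \<Longrightarrow> f w = g w"
  shows "(g has_derivative D) (at z)"
  by (rule has_derivative_transform_within_open[OF assms(2) open_ball[of 0 1]]) (use assms in auto)

text \<open>The quotient rule is arranged for \<open>g'\<close> equal to a multiple of
  \<open>f\<close>: then \<open>h z * g' / (1 - g z)\<close> is quadratic in \<open>h z\<close>,
  which supplies the missing square term of the first equation.\<close>

lemma has_lie_derivative_quotient:
  assumes z: "norm z < 1"
    and f: "has_lie_derivative f l z f'" and g: "has_lie_derivative g l z g'"
    and nz: "1 - g z \<noteq> 0" and h: "\<And>w. norm w < 1 \<Longrightarrow> h w = f w / (1 - g w)"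
  shows "has_lie_derivative h l z ((f' + h z * g') / (1 - g z))"
proof -
  obtain Df Dg where Df: "(f has_derivative Df) (at z)" "Df (diag_field l z) = f'"
    and Dg: "(g has_derivative Dg) (at z)" "Dg (diag_field l z) = g'"
    using f g unfolding has_lie_derivative_def by blast
  have "((\<lambda>w. f w / (1 - g w)) has_derivative
      (\<lambda>k. (Df k * (1 - g z) - f z * (0 - Dg k)) / ((1 - g z) * (1 - g z)))) (at z)"
    by (intro has_derivative_divide' has_derivative_diff has_derivative_const Df Dg nz)
  hence "(h has_derivative (\<lambda>k. (Df k * (1 - g z) - f z * (0 - Dg k)) / ((1 - g z) * (1 - g z)))) (at z)"
    by (rule has_derivative_on_unit_ball[OF z]) (simp add: h)
  moreover have "(Df (diag_field l z) * (1 - g z) - f z * (0 - Dg (diag_field l z))) / ((1 - g z) * (1 - g z))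
      = (f' + h z * g') / (1 - g z)"
    using nz by (simp add: Df(2) Dg(2) h[OF z] divide_simps)
  ultimately show ?thesis
    unfolding has_lie_derivative_def by blast
qed

lemma lv_linearization_bernoulli:
  fixes \<zeta> :: complex and A :: "complex^3^3"
  assumes \<zeta>: "\<zeta>^3 = 1" "\<zeta> \<noteq> 1"
    and A: "A $ 2 $ 1 = 0" "A $ 3 $ 1 = 0" "A $ 2 $ 3 = 0" "\<zeta> * A $ 1 $ 2 = A $ 3 $ 2"
  shows "\<exists>h. convergent_ps_order_ge_2 h \<and>
    transforms_near_0 (\<lambda>y. y + h y) (lv_field (zeta_spectrum \<zeta>) A) (diag_field (zeta_spectrum \<zeta>))"
proof -
  define l where "l = zeta_spectrum \<zeta>"
  \<comment> \<open>The lower entries of the first column vanish by assumption, so deleting the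
    column removes only \<open>A $ 1 $ 1\<close>.\<close>
  define B :: "complex^3^3" where "B = (\<chi> i j. if j = 1 then 0 else A $ i $ j)"
  define a where "a = (\<Sum>i\<in>UNIV. \<Sum>j\<in>UNIV. norm (B $ i $ j))"
  have a: "0 \<le> a" by (simp add: a_def sum_nonneg)
  \<comment> \<open>One radius serves both the contraction for \<open>B\<close> and the smallness of
    \<open>W\<close> needed for the geometric series.\<close>
  obtain r where r: "0 < r" "r * (a + norm (A $ 1 $ 1)) \<le> 1 / 8"
    using exists_small_radius[of "a + norm (A $ 1 $ 1)"] a by auto
  have ra: "r * a \<le> 1 / 8" and rA: "r * norm (A $ 1 $ 1) \<le> 1 / 8"
  proof -
    have "0 \<le> r * a" "0 \<le> r * norm (A $ 1 $ 1)" using r(1) a by simp_all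
    thus "r * a \<le> 1 / 8" "r * norm (A $ 1 $ 1) \<le> 1 / 8" using r(2) unfolding distrib_left by linarith+
  qed
  have B: "B $ 1 $ 1 = 0" "B $ 2 $ 3 = 0" "\<zeta> * B $ 1 $ 2 = B $ 3 $ 2"
    using A by (simp_all add: B_def)
  have notin: "(1 :: 3) \<notin> {2, 3}" by simp
  have nonres: "1 \<le> norm (weight l \<alpha>)" if "\<alpha> \<noteq> 0" "\<And>j. j \<notin> {2, 3} \<Longrightarrow> \<alpha> j = 0" for \<alpha>
  proof -
    have "{2, 3} \<noteq> (UNIV :: 3 set)" using notin by blast
    from norm_weight_ge_1_of_support[OF \<zeta> this that] show ?thesis unfolding l_def .
  qed
  have supp: "j \<in> {2, 3} \<and> {2, 3} \<subseteq> {2, 3 :: 3}" if "B $ i $ j \<noteq> 0" for i j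
    using that exhaust_3[of j] by (auto simp: B_def split: if_splits)
  obtain X where X: "\<And>i. X $ i = 1 + weight_inv l (quad_term r B X i)"
    and X2: "\<And>i. norm (X $ i) \<le> 2" and XV: "\<And>i. X $ i \<in> supported {2, 3}"
    and X0: "\<And>i. coeff (X $ i) 0 = 1"
    and lie: "\<And>i z. norm z < 1 \<Longrightarrow> has_lie_derivative (\<lambda>z. eval z (X $ i)) l z
      (eval z (X $ i) * (\<Sum>j\<in>UNIV. of_real r * B $ i $ j * z $ j * eval z (X $ j)))"
    by (rule exists_nonresonant_solution[where A = B and V = "\<lambda>_. {2, 3}" and l = l and r = r])
       (use r ra supp nonres in \<open>auto simp: a_def\<close>)
  define q where "q = monomial (unit_index 1) (of_real r * A $ 1 $ 1) * X $ 1"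
  define W where "W = weight_inv l q"
  have coeff_q: "coeff q \<alpha> = (if \<alpha> 1 = 0 then 0 else of_real r * A $ 1 $ 1 * coeff (X $ 1) (\<alpha> - unit_index 1))" for \<alpha>
    by (simp add: q_def coeff_monomial_mult unit_index_le_iff)
  \<comment> \<open>As \<open>X $ 1\<close> does not involve the first variable, every exponent in
    \<open>q\<close> has \<open>\<alpha> 1 = 1\<close>. A resonance must then be
    \<open>(1, 1, 1)\<close>, whose coefficient comes from that of
    \<open>y\<^sub>2 y\<^sub>3\<close> in \<open>X $ 1\<close>.\<close>
  have "1 \<le> norm (weight l \<alpha>)" if q: "coeff q \<alpha> \<noteq> 0" for \<alpha>
  proof (rule ccontr)
    assume "\<not> 1 \<le> norm (weight l \<alpha>)"
    hence eq: "\<alpha> 1 = \<alpha> 2 \<and> \<alpha> 2 = \<alpha> 3"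
      using norm_weight_ge_1[OF \<zeta>, of \<alpha>] unfolding l_def by blast
    have nz: "\<alpha> 1 \<noteq> 0" "coeff (X $ 1) (\<alpha> - unit_index 1) \<noteq> 0"
      using q by (auto simp: coeff_q split: if_splits)
    have "(\<alpha> - unit_index 1) 1 = 0"
      using nz(2) XV[of 1] notin unfolding supported_def by blast
    hence "\<alpha> 1 = 1" using nz(1) by (simp add: unit_index_def)
    hence "\<alpha> - unit_index 1 = unit_index 2 + unit_index 3"
      using eq by (simp add: fun_eq_iff forall_3 unit_index_def)
    with nz(2) resonant_coeff_eq_0[OF \<zeta> X[unfolded l_def] X0 B] show False by simp
  qed
  hence W_coeff: "weight l \<alpha> * coeff W \<alpha> = coeff q \<alpha>" for \<alpha>
    unfolding W_def by (intro weight_mult_coeff_weight_inv)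
  have "norm W \<le> norm q" unfolding W_def by (rule norm_weight_inv_le)
  also have "\<dots> \<le> norm (of_real r * A $ 1 $ 1) * norm (X $ 1)"
    unfolding q_def by (rule order_trans[OF norm_mult_ineq]) simp
  also have "\<dots> \<le> 1 / 8 * 2"
    using X2[of 1] rA r(1) by (intro mult_mono) (auto simp: norm_mult)
  finally have W: "norm W < 1" by simp
  have W0: "coeff W 0 = 0" by (simp add: W_def weight_inv.rep_eq)
  \<comment> \<open>The Neumann series represents \<open>X\<^sub>1 / (1 - W)\<close> within the
    algebra; the other two components need no correction.\<close>
  define Y where "Y = (\<chi> i. if i = 1 then X $ 1 * (\<Sum>n. W ^ n) else X $ i)"
  have Y1: "eval z (Y $ 1) = eval z (X $ 1) / (1 - eval z W)" if "norm z < 1" for z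
    using that by (simp add: Y_def eval_mult eval_geometric[OF _ W])
  have Y': "Y $ i = X $ i" if "i \<noteq> 1" for i
    using that by (simp add: Y_def)
  show ?thesis
    unfolding l_def[symmetric]
  proof (rule lv_linearization[OF r(1)])
    show "coeff (Y $ i) 0 = 1" for i
    proof (cases "i = 1")
      case True
      have "eval 0 (Y $ 1) = 1" unfolding Y1[of 0, simplified] by (simp add: eval_at_0 X0 W0)
      thus ?thesis using True by (simp add: eval_at_0)
    qed (simp add: Y' X0)
    fix i and z :: "complex^3" assume z: "norm z < 1"
    show "has_lie_derivative (\<lambda>z. eval z (Y $ i)) l z
      (eval z (Y $ i) * (\<Sum>j\<in>UNIV. of_real r * A $ i $ j * z $ j * eval z (Y $ j)))"
    proof (cases "i = 1")
      case True
      have nz: "1 - eval z W \<noteq> 0"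
        using norm_eval_le[of z W] z W by auto
      have evq: "eval z q = of_real r * A $ 1 $ 1 * z $ 1 * eval z (X $ 1)"
        using z by (simp add: q_def eval_mult eval_monomial zpow_unit_index)
      have "has_lie_derivative (\<lambda>z. eval z (Y $ 1)) l z
          ((eval z (X $ 1) * (\<Sum>j\<in>UNIV. of_real r * B $ 1 $ j * z $ j * eval z (X $ j))
            + eval z (Y $ 1) * eval z q) / (1 - eval z W))"
        by (rule has_lie_derivative_quotient[OF z lie[OF z] eval_has_lie_derivative[OF z W_coeff] nz Y1])
      also have "(eval z (X $ 1) * (\<Sum>j\<in>UNIV. of_real r * B $ 1 $ j * z $ j * eval z (X $ j))
            + eval z (Y $ 1) * eval z q) / (1 - eval z W)
          = eval z (Y $ 1) * (\<Sum>j\<in>UNIV. of_real r * A $ 1 $ j * z $ j * eval z (Y $ j))"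
        using nz by (simp add: sum_3 B_def Y' evq Y1[OF z] field_simps)
      finally show ?thesis using True by simp
    next
      case False
      hence "A $ i $ 1 = 0" using A exhaust_3[of i] by auto
      hence "(\<Sum>j\<in>UNIV. of_real r * A $ i $ j * z $ j * eval z (Y $ j))
          = (\<Sum>j\<in>UNIV. of_real r * B $ i $ j * z $ j * eval z (X $ j))"
        by (intro sum.cong) (auto simp: B_def Y')
      thus ?thesis using lie[OF z, of i] by (simp only: Y'[OF False])
    qed
  qed
qed

section \<open>The five families of parameters\<close>

theorem theorem8:
  fixes \<zeta> :: complex and p :: params
  assumes "\<zeta>^3 = 1" and "\<zeta> \<noteq> 1"
    and "p \<in> variety J1 \<or> p \<in> variety J4 \<or> p \<in> variety J5 \<or> p \<in> variety J8 \<or>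
         p \<in> variety (J9 \<zeta>)"
  shows "linearizable \<zeta> (sys_field \<zeta> p)"
proof -
  note \<zeta> = assms(1,2)
  let ?A = "interaction \<zeta> p"
  have by_supports: "linearizable \<zeta> (sys_field \<zeta> p)"
    if "\<And>i j. ?A $ i $ j \<noteq> 0 \<Longrightarrow> j \<in> V i \<and> V j \<subseteq> V i" and "\<And>i. V i \<noteq> UNIV" for V
    unfolding linearizable_def sys_field_eq_lv_field lin_field_eq_diag_field
    by (rule lv_linearization_of_nonresonant_supports[OF that(1)], assumption)
       (rule norm_weight_ge_1_of_support[OF \<zeta> that(2)])
  have proper: "{1, 2} \<noteq> (UNIV :: 3 set)" "{2, 3} \<noteq> (UNIV :: 3 set)" "{2} \<noteq> (UNIV :: 3 set)" "{3} \<noteq> (UNIV :: 3 set)"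
  proof -
    have "(1 :: 3) \<notin> {2, 3}" "(1 :: 3) \<notin> {2}" "(1 :: 3) \<notin> {3}" "(3 :: 3) \<notin> {1, 2}" by simp_all
    thus "{1, 2} \<noteq> (UNIV :: 3 set)" "{2, 3} \<noteq> (UNIV :: 3 set)" "{2} \<noteq> (UNIV :: 3 set)" "{3} \<noteq> (UNIV :: 3 set)"
      by blast+
  qed
  consider "c001 p = 0" "a001 p = 0" | "b100 p = 0" "a100 p = 0" | "b100 p = 0" "a001 p = 0"
    | "c010 p = 0" "a001 p = 0" | "b100 p = 0" "a010 p = \<zeta> * c010 p"
    using assms(3) by (auto simp: variety_def J1_def J4_def J5_def J8_def J9_def)
  thus ?thesis
  proof cases
    case 1
    \<comment> \<open>For \<open>J1\<close> the third column of the interaction matrix vanishes, so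
      a common support without the third variable works.\<close>
    hence "\<forall>i j. ?A $ i $ j \<noteq> 0 \<longrightarrow> j \<in> {1, 2} \<and> {1, 2} \<subseteq> {1, 2 :: 3}"
      by (simp add: forall_3)
    thus ?thesis by (intro by_supports[of "\<lambda>_. {1, 2}"]) (use proper in auto)
  next
    case 2
    \<comment> \<open>For \<open>J4\<close> it is the first column that vanishes.\<close>
    hence "\<forall>i j. ?A $ i $ j \<noteq> 0 \<longrightarrow> j \<in> {2, 3} \<and> {2, 3} \<subseteq> {2, 3 :: 3}"
      by (simp add: forall_3)
    thus ?thesis by (intro by_supports[of "\<lambda>_. {2, 3}"]) (use proper in auto)
  next
    case 3
    \<comment> \<open>For \<open>J5\<close> the second equation is autonomous and drives the other
      two, which do not interact with each other.\<close>
    define V where "V i = (if i = 1 then {1, 2} else if i = 2 then {2} else {2, 3 :: 3})" for i :: 3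
    from 3 have "\<forall>i j. ?A $ i $ j \<noteq> 0 \<longrightarrow> j \<in> V i \<and> V j \<subseteq> V i"
      by (simp add: forall_3 V_def)
    thus ?thesis by (intro by_supports[of V]) (use proper in \<open>auto simp: V_def\<close>)
  next
    case 4
    \<comment> \<open>For \<open>J8\<close> the system decouples into the first two equations and
      the third.\<close>
    define V where "V i = (if i = 3 then {3} else {1, 2 :: 3})" for i :: 3
    from 4 have "\<forall>i j. ?A $ i $ j \<noteq> 0 \<longrightarrow> j \<in> V i \<and> V j \<subseteq> V i"
      by (simp add: forall_3 V_def)
    thus ?thesis by (intro by_supports[of V]) (use proper in \<open>auto simp: V_def\<close>)
  next
    case 5
    show ?thesis
      unfolding linearizable_def sys_field_eq_lv_field lin_field_eq_diag_field
      \<comment> \<open>Multiplying the relation of \<open>J9\<close> by \<open>\<zeta>\<close>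
        gives the condition linking the entries \<open>(1, 2)\<close> and \<open>(3, 2)\<close> of
        the matrix.\<close>
      by (rule lv_linearization_bernoulli[OF \<zeta>]) (use 5 in \<open>simp_all add: power2_eq_square\<close>)
  qed
qed

end
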